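(* Let $\lambda>1$ be an integer, $0<\varepsilon\le1/2$, $0<t\le1$ and $0<\rho<1$. Let $\varphi$, $\widetilde\psi^{j,\ell}$, $\ell_{\lambda^j}$ be as defined in the context, and, for a function $g$ on $\mathbb{T}^2$ with $g\equiv1$ on $\mathrm{supp}\,\varphi$, let $a$ and $b^{j,\ell}$ ($j\ge0$, $|\ell|\le\ell_{\lambda^j}$) be the $2\pi\mathbb{Z}^2$-periodic functions defined in the context. Then there exists $g\in C^\infty(\mathbb{T}^2)$ such that $a,b^{j,\ell}\in C^\infty(\mathbb{T}^2)$ for all $j\ge0$, $\ell=-\ell_{\lambda^j},\dots,\ell_{\lambda^j}$, and for a.e. $\xi\in\mathbb{R}^2$ $$\varphi(M_\lambda\xi)=a(\xi)\varphi(\xi)\quad\text{and}\quad\widetilde\psi^{j,\ell}(M_\lambda\xi)=b^{j,\ell}(\xi)\varphi(\xi).$$ Moreover, $\{a;\,b^{j,\ell},b^{j,\ell}(E\cdot):\ell=-\ell_{\lambda^j},\dots,\ell_{\lambda^j}\}$ is a filter bank having the perfect reconstruction property, i.e., $$|a(\xi)|^2+\sum_{\ell=-\ell_{\lambda^j}}^{\ell_{\lambda^j}}\big(|b^{j,\ell}(\xi)|^2+|b^{j,\ell}(E\xi)|^2\big)=1,\quad\text{a.e. }\xi\in\sigma_\varphi,$$ and $$\overline{a(\xi)}a(\xi+2\pi\varpi)+\sum_{\ell=-\ell_{\lambda^j}}^{\ell_{\lambda^j}}\Big[\overline{b^{j,\ell}(\xi)}b^{j,\ell}(\xi+2\pi\varpi)+\overline{b^{j,\ell}(E\xi)}b^{j,\ell}(E\xi+2\pi\varpi)\Big]=0$$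 for a.e. $\xi\in\sigma_\varphi\cap(\sigma_\varphi-2\pi\varpi)$ and all $\varpi\in\Omega_{M_\lambda}\setminus\{0\}$, where $\Omega_{M_\lambda}=[M_\lambda^{-1}\mathbb{Z}^2]\cap[0,1)^2$ and $\sigma_\varphi:=\{\xi\in\mathbb{R}^2:\sum_{k\in\mathbb{Z}^2}|\varphi(\xi+2\pi k)|^2\neq0\}$.
   Context: $E=\begin{bmatrix}0&1\\1&0\end{bmatrix}$, $M_\lambda=\lambda^2I_2$. $C^\infty(\mathbb{T}^2)$ denotes smooth $2\pi\mathbb{Z}^2$-periodic functions on $\mathbb{R}^2$; $\mathbb{T}^2$ is identified with $[-\pi,\pi]^2$ with opposite sides glued. One-dimensional functions. Fix a function $\nu\in C^\infty(\mathbb{R})$ such that $\nu(x)=0$ for $x\le-1$, $\nu(x)=1$ for $x\ge1$, and $|\nu(x)|^2+|\nu(-x)|^2=1$ for all $x\in\mathbb{R}$. (There are many choices of such functions; for example, $\nu(x)=g_0(x)/\sqrt{|g_0(x)|^2+|g_0(-x)|^2}$ with $g_0(x)=\int_{-1}^xf_0(1+s)f_0(1-s)\,ds$, $f_0(x)=e^{-1/x^2}$ for $x>0$ and $f_0(x)=0$ for $x\le0$.) Put $$\alpha(x):=\nu\Big(\frac{-2\lambda^2|x|+(2-t)\rho\pi}{t\rho\pi}\Big),\quad \gamma_\varepsilon(x):=\nu\Big(\frac{1/2-|x|}{\varepsilon}\Big),\quad x\in\mathbb{R},$$ and $\ell_\kappa:=\lfloor\kappa+1/2-\varepsilon\rfloor$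 for $\kappa\ge1$. Let $\mu$ be the $2\pi$-periodic function with $\mu(x)=\alpha(\lambda^2x)/\alpha(x)$ for $|x|<\lambda^{-2}\rho\pi$ and $\mu(x)=0$ for $\lambda^{-2}\rho\pi\le|x|\le\pi$. Convention: for $\xi=(\xi_1,\xi_2)\neq0$, $\gamma_\varepsilon(\cdot)$ with an argument involving a quotient with zero denominator is $0$. Two-dimensional functions. $\varphi(\xi):=\alpha(\xi_1)\alpha(\xi_2)$, $\omega(\xi):=\sqrt{|\varphi(\lambda^{-2}\xi)|^2-|\varphi(\xi)|^2}$, and for $\xi\ne0$, $|\ell|\le\ell_{\lambda^j}$, $$\Gamma_j(\xi):=\sum_{m=-\ell_{\lambda^j}}^{\ell_{\lambda^j}}\big(|\gamma_\varepsilon(\lambda^j\xi_2/\xi_1+m)|^2+|\gamma_\varepsilon(\lambda^j\xi_1/\xi_2+m)|^2\big),\qquad \widetilde\psi^{j,\ell}(\xi):=\omega(\xi)\frac{\gamma_\varepsilon(\lambda^j\xi_2/\xi_1+\ell)}{\sqrt{\Gamma_j(\xi)}},$$ with $\widetilde\psi^{j,\ell}(0):=0$. Masks: $a(\xi):=\mu(\xi_1)\mu(\xi_2)$; on $[-\pi,\pi]^2$ (extended $2\pi\mathbb{Z}^2$-periodically) $b(\xi):=\sqrt{g(\xi)-|a(\xi)|^2}$ and $b^{j,\ell}(\xi):=b(\xi)\,\gamma_\varepsilon(\lambda^j\xi_2/\xi_1+\ell)/\sqrt{\Gamma_j(\xi)}$, with $b^{j,\ell}(0):=0$.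
   Formalization: The function ν is taken real-valued and additionally assumed nondecreasing; without this μ can have a zero denominator, the refinement equations can fail, and b need not be smooth. The explicit example of ν is nondecreasing. *)

theory Defs
  imports "HOL-Analysis.Analysis"
begin

text \<open>Functions of class \<open>C\<^sup>k\<close> and \<open>C\<^sup>\<infinity>\<close> on a whole Euclidean space:
  all iterated directional derivatives exist and are continuous.\<close>

primrec Ck :: "nat \<Rightarrow> ('a::euclidean_space \<Rightarrow> 'b::real_normed_vector) \<Rightarrow> bool" where
  "Ck 0 f \<longleftrightarrow> continuous_on UNIV f"
| "Ck (Suc k) f \<longleftrightarrow>
     (\<forall>x. f differentiable (at x)) \<and> (\<forall>v. Ck k (\<lambda>x. frechet_derivative f (at x) v))"

definition Csmooth :: "('a::euclidean_space \<Rightarrow> 'b::real_normed_vector) \<Rightarrow> bool" where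
  "Csmooth f \<longleftrightarrow> (\<forall>k. Ck k f)"

definition Z2 :: "(real^2) set" where
  "Z2 = {k. \<forall>i. k $ i \<in> \<int>}"

text \<open>Functions on the torus are \<open>2\<pi>\<int>\<^sup>2\<close>-periodic functions on the plane.\<close>

definition periodic2 :: "(real^2 \<Rightarrow> 'b) \<Rightarrow> bool" where
  "periodic2 f \<longleftrightarrow> (\<forall>\<xi>. \<forall>k\<in>Z2. f (\<xi> + (2 * pi) *\<^sub>R k) = f \<xi>)"

definition torus_smooth :: "(real^2 \<Rightarrow> real) \<Rightarrow> bool" where
  "torus_smooth f \<longleftrightarrow> Csmooth f \<and> periodic2 f"

text \<open>The representative of a point modulo \<open>2\<pi>\<close> in \<open>[-\<pi>,\<pi>)\<close>, used for periodic extensions from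
  \<open>[-\<pi>,\<pi>]\<close>. If a formula is continuous on \<open>[-\<pi>,\<pi>]\<^sup>2\<close> away from the origin, then continuity of
  the extension forces the values of the formula on opposite edges to agree, so the choice of
  the half-open square is immaterial.\<close>

definition wrap :: "real \<Rightarrow> real" where
  "wrap x = x - 2 * pi * of_int \<lfloor>(x + pi) / (2 * pi)\<rfloor>"

definition wrap2 :: "real^2 \<Rightarrow> real^2" where
  "wrap2 \<xi> = (\<chi> i. wrap (\<xi> $ i))"

definition E_mat :: "real^2^2" where
  "E_mat = vector [vector [0, 1], vector [1, 0]]"

definition M_mat :: "nat \<Rightarrow> real^2^2" where
  "M_mat lam = mat ((real lam)\<^sup>2)"

text \<open>These conditions alone guarantee neither that the quotient defining \<open>\<mu>\<close> below has a
  nonzero denominator where its numerator is nonzero, nor that the radicand of \<open>\<omega>\<close> is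
  nonnegative, nor that the square root defining \<open>b\<close> is smooth. All three follow if \<open>\<nu>\<close> is
  also monotone, as it is for the standard choice
  \<open>g\<^sub>0(x) / sqrt (\<bar>g\<^sub>0(x)\<bar>\<^sup>2 + \<bar>g\<^sub>0(-x)\<bar>\<^sup>2)\<close>.\<close>

definition transition_fn :: "(real \<Rightarrow> real) \<Rightarrow> bool" where
  "transition_fn \<nu> \<longleftrightarrow> Csmooth \<nu> \<and> (\<forall>x\<le>-1. \<nu> x = 0) \<and> (\<forall>x\<ge>1. \<nu> x = 1) \<and>
     (\<forall>x. \<bar>\<nu> x\<bar>\<^sup>2 + \<bar>\<nu> (- x)\<bar>\<^sup>2 = 1)"

definition alpha_fn :: "(real \<Rightarrow> real) \<Rightarrow> nat \<Rightarrow> real \<Rightarrow> real \<Rightarrow> real \<Rightarrow> real" where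
  "alpha_fn \<nu> lam t \<rho> x =
     \<nu> ((- 2 * (real lam)\<^sup>2 * \<bar>x\<bar> + (2 - t) * \<rho> * pi) / (t * \<rho> * pi))"

definition gamma_fn :: "(real \<Rightarrow> real) \<Rightarrow> real \<Rightarrow> real \<Rightarrow> real" where
  "gamma_fn \<nu> \<epsilon> x = \<nu> ((1/2 - \<bar>x\<bar>) / \<epsilon>)"

text \<open>\<open>\<gamma>\<^sub>\<epsilon>(c x / y + m)\<close>, with value \<open>0\<close> if \<open>y = 0\<close> (as opposed to \<open>\<gamma>\<^sub>\<epsilon>(m)\<close>, which
  the totalised division would give).\<close>

definition gamma_quot :: "(real \<Rightarrow> real) \<Rightarrow> real \<Rightarrow> real \<Rightarrow> real \<Rightarrow> real \<Rightarrow> int \<Rightarrow> real" where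
  "gamma_quot \<nu> \<epsilon> c x y m = (if y = 0 then 0 else gamma_fn \<nu> \<epsilon> (c * x / y + of_int m))"

definition ell :: "real \<Rightarrow> real \<Rightarrow> int" where
  "ell \<epsilon> \<kappa> = \<lfloor>\<kappa> + 1/2 - \<epsilon>\<rfloor>"

definition mu_fn :: "(real \<Rightarrow> real) \<Rightarrow> nat \<Rightarrow> real \<Rightarrow> real \<Rightarrow> real \<Rightarrow> real" where
  "mu_fn \<nu> lam t \<rho> x =
     (let y = wrap x in
      if \<bar>y\<bar> < \<rho> * pi / (real lam)\<^sup>2
      then alpha_fn \<nu> lam t \<rho> ((real lam)\<^sup>2 * y) / alpha_fn \<nu> lam t \<rho> y
      else 0)"

definition phi_fn :: "(real \<Rightarrow> real) \<Rightarrow> nat \<Rightarrow> real \<Rightarrow> real \<Rightarrow> real^2 \<Rightarrow> real" where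
  "phi_fn \<nu> lam t \<rho> \<xi> = alpha_fn \<nu> lam t \<rho> (\<xi> $ 1) * alpha_fn \<nu> lam t \<rho> (\<xi> $ 2)"

definition omega_fn :: "(real \<Rightarrow> real) \<Rightarrow> nat \<Rightarrow> real \<Rightarrow> real \<Rightarrow> real^2 \<Rightarrow> real" where
  "omega_fn \<nu> lam t \<rho> \<xi> =
     sqrt (\<bar>phi_fn \<nu> lam t \<rho> ((1 / (real lam)\<^sup>2) *\<^sub>R \<xi>)\<bar>\<^sup>2 - \<bar>phi_fn \<nu> lam t \<rho> \<xi>\<bar>\<^sup>2)"

definition Gamma_fn :: "(real \<Rightarrow> real) \<Rightarrow> nat \<Rightarrow> real \<Rightarrow> nat \<Rightarrow> real^2 \<Rightarrow> real" where
  "Gamma_fn \<nu> lam \<epsilon> j \<xi> =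
     (\<Sum>m = - ell \<epsilon> (real lam ^ j)..ell \<epsilon> (real lam ^ j).
        \<bar>gamma_quot \<nu> \<epsilon> (real lam ^ j) (\<xi> $ 2) (\<xi> $ 1) m\<bar>\<^sup>2 +
        \<bar>gamma_quot \<nu> \<epsilon> (real lam ^ j) (\<xi> $ 1) (\<xi> $ 2) m\<bar>\<^sup>2)"

definition psi_fn ::
  "(real \<Rightarrow> real) \<Rightarrow> nat \<Rightarrow> real \<Rightarrow> real \<Rightarrow> real \<Rightarrow> nat \<Rightarrow> int \<Rightarrow> real^2 \<Rightarrow> real" where
  "psi_fn \<nu> lam t \<rho> \<epsilon> j l \<xi> =
     (if \<xi> = 0 then 0
      else omega_fn \<nu> lam t \<rho> \<xi> * gamma_quot \<nu> \<epsilon> (real lam ^ j) (\<xi> $ 2) (\<xi> $ 1) l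
             / sqrt (Gamma_fn \<nu> lam \<epsilon> j \<xi>))"

definition mask_a :: "(real \<Rightarrow> real) \<Rightarrow> nat \<Rightarrow> real \<Rightarrow> real \<Rightarrow> real^2 \<Rightarrow> real" where
  "mask_a \<nu> lam t \<rho> \<xi> = mu_fn \<nu> lam t \<rho> (\<xi> $ 1) * mu_fn \<nu> lam t \<rho> (\<xi> $ 2)"

definition mask_b ::
  "(real \<Rightarrow> real) \<Rightarrow> nat \<Rightarrow> real \<Rightarrow> real \<Rightarrow> (real^2 \<Rightarrow> real) \<Rightarrow> real^2 \<Rightarrow> real" where
  "mask_b \<nu> lam t \<rho> g \<xi> =
     (let \<eta> = wrap2 \<xi> in sqrt (g \<eta> - \<bar>mask_a \<nu> lam t \<rho> \<eta>\<bar>\<^sup>2))"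

definition mask_bjl ::
  "(real \<Rightarrow> real) \<Rightarrow> nat \<Rightarrow> real \<Rightarrow> real \<Rightarrow> real \<Rightarrow> (real^2 \<Rightarrow> real) \<Rightarrow> nat \<Rightarrow> int \<Rightarrow> real^2 \<Rightarrow> real"
  where
  "mask_bjl \<nu> lam t \<rho> \<epsilon> g j l \<xi> =
     (let \<eta> = wrap2 \<xi> in
      if \<eta> = 0 then 0
      else mask_b \<nu> lam t \<rho> g \<eta> * gamma_quot \<nu> \<epsilon> (real lam ^ j) (\<eta> $ 2) (\<eta> $ 1) l
             / sqrt (Gamma_fn \<nu> lam \<epsilon> j \<eta>))"

text \<open>\<open>\<Omega>\<^bsub>M\<^esub> = [M\<^sup>-\<^sup>1\<int>\<^sup>2] \<inter> [0,1)\<^sup>2\<close>\<close>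

definition Omega_set :: "nat \<Rightarrow> (real^2) set" where
  "Omega_set lam =
     (\<lambda>k. matrix_inv (M_mat lam) *v k) ` Z2 \<inter> {w. \<forall>i. 0 \<le> w $ i \<and> w $ i < 1}"

text \<open>For compactly supported functions the sum has only finitely many nonzero terms.\<close>

definition sigma_set :: "(real^2 \<Rightarrow> real) \<Rightarrow> (real^2) set" where
  "sigma_set f = {\<xi>. (\<Sum>\<^sub>\<infinity>k\<in>Z2. \<bar>f (\<xi> + (2 * pi) *\<^sub>R k)\<bar>\<^sup>2) \<noteq> 0}"

end

theory Submission
  imports Defs
begin

text \<open>
  Write \<open>N = \<lambda>\<^sup>2\<close>. The algebraic identities hold pointwise and are short. The refinement equations
  restate the definitions of \<open>\<mu>\<close> as a quotient and of \<open>\<omega>\<close> as a root (\<open>refinement_a\<close>,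
  \<open>refinement_b\<close>). The window functions are normalised by \<open>\<Gamma>\<close>, so the squares of the \<open>b\<^bsup>j,l\<^esup>\<close> and
  their reflections add up to \<open>g - \<bar>a\<bar>\<^sup>2\<close>, which is \<open>1 - \<bar>a\<bar>\<^sup>2\<close> on \<open>\<sigma>\<^sub>\<phi>\<close>
  (\<open>perfect_reconstruction\<close>). The cross terms have to vanish only on the intersection of \<open>\<sigma>\<^sub>\<phi>\<close>
  with a translate, and this intersection is empty since \<open>\<phi>\<close> is supported in a small square
  (\<open>sigma_disjoint\<close>).

  The substance is smoothness. Take \<open>g = H\<^sup>2\<close> for a smooth periodic cutoff \<open>H\<close> that is \<open>1\<close> where
  \<open>a\<close> or \<open>\<phi>\<close> is nonzero and \<open>0\<close> near the edges of \<open>[-\<pi>, \<pi>]\<^sup>2\<close>. Then \<open>g - \<bar>a\<bar>\<^sup>2 = H\<^sup>2 (1 - \<bar>a\<bar>\<^sup>2)\<close>,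
  and \<open>b\<^bsup>j,l\<^esup>\<close> is \<open>H\<close> times the root of \<open>S = 1 - \<bar>a\<bar>\<^sup>2\<close> times an angular factor that is
  homogeneous of degree \<open>0\<close> and smooth off the origin. A root of a nonnegative smooth function
  need not be smooth, and \<open>S\<close> can have many zeros, because \<open>\<nu>\<close> may have plateaus, even infinitely
  many of them accumulating at \<open>-1\<close>.

  What saves the argument is monotonicity. Near its zeros \<open>S\<close> is a combination, with smooth
  nonnegative coefficients, of increments \<open>\<alpha>(x)\<^sup>2 - \<alpha>(N x)\<^sup>2\<close>, and such an increment is the
  oscillation of a monotone function on the segment from \<open>x\<close> to \<open>N x\<close>. By interpolation, all
  derivatives at the ends of the segment are bounded by every power less than \<open>1\<close> of the
  oscillation (\<open>derivatives_bounded_by_oscillation\<close>, \<open>D_derivs_bound\<close>); the shrinking of the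
  segment at \<open>x = 0\<close> does no harm since the oscillation decreases there faster than any power of
  \<open>\<bar>x\<bar>\<close>. Hence all derivatives of \<open>S\<close> are \<open>O(S\<^sup>p)\<close> for every \<open>p < 1\<close>. Consequently those of \<open>S\<^sup>r\<close>
  are \<open>O(S\<^sup>p)\<close> for every \<open>p < r\<close> (\<open>tame_powr\<close>). Moreover, \<open>S\<close> vanishes to infinite order at its
  zeros, among them the origin, so the angular factor loses less than any power of \<open>S\<close>
  (\<open>homogeneous_tame\<close>). A product of positive order tends to \<open>0\<close> at the zeros of \<open>S\<close> together with
  all its derivatives, and is therefore smooth (\<open>extend_Ck_on\<close>, \<open>sqrt_S_angular_smooth\<close>).
\<close>

section \<open>Iterated directional derivatives on open sets\<close>

text \<open>
  The predicate \<open>A\<close> is a parameter because the same calculus serves twice: with \<open>A\<close> continuity it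
  gives functions of class \<open>C\<^sup>k\<close> on an open set, and with \<open>A\<close> a growth bound in terms of a weight
  it gives the graded algebra in which the square root of the weight lives.
\<close>

primrec derivs_satisfy ::
  "'a::euclidean_space set \<Rightarrow> (('a \<Rightarrow> real) \<Rightarrow> bool) \<Rightarrow> nat \<Rightarrow> ('a \<Rightarrow> real) \<Rightarrow> bool" where
  "derivs_satisfy U A 0 f \<longleftrightarrow> A f"
| "derivs_satisfy U A (Suc k) f \<longleftrightarrow> A f \<and> (\<forall>x\<in>U. f differentiable (at x)) \<and>
     (\<forall>v. derivs_satisfy U A k (\<lambda>x. frechet_derivative f (at x) v))"

text \<open>
  The sum, product and chain rules determine derivatives only on \<open>U\<close>, so \<open>A\<close> has to be insensitive
  to values outside \<open>U\<close> for these rules to be usable.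
\<close>

definition depends_on :: "'a set \<Rightarrow> (('a \<Rightarrow> real) \<Rightarrow> bool) \<Rightarrow> bool" where
  "depends_on U A \<longleftrightarrow> (\<forall>f g. A f \<longrightarrow> (\<forall>x\<in>U. f x = g x) \<longrightarrow> A g)"

lemma frechet_derivative_eq:
  "(f has_derivative F) (at x) \<Longrightarrow> frechet_derivative f (at x) = F"
  using frechet_derivative_at by metis

lemma has_derivative_cong_open:
  assumes "open U" "x \<in> U" "\<And>y. y \<in> U \<Longrightarrow> f y = g y" "(f has_derivative F) (at x)"
  shows "(g has_derivative F) (at x)"
  using has_derivative_transform_within_open[OF assms(4,1,2)] assms(3) by blast

lemma derivs_satisfy_cong:
  assumes "open U" "depends_on U A" "derivs_satisfy U A k f" "\<And>x. x \<in> U \<Longrightarrow> f x = g x"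
  shows "derivs_satisfy U A k g"
  using assms(3,4)
proof (induction k arbitrary: f g)
  case 0
  then show ?case using assms(2) unfolding depends_on_def by auto
next
  case (Suc k)
  have hd: "(f has_derivative frechet_derivative f (at x)) (at x)" if "x \<in> U" for x
    using Suc.prems(1) that by (simp add: frechet_derivative_works)
  have hg: "(g has_derivative frechet_derivative f (at x)) (at x)" if "x \<in> U" for x
    using has_derivative_cong_open[OF assms(1) that Suc.prems(2) hd[OF that]] by blast
  have "A g" using Suc.prems assms(2) unfolding depends_on_def by auto
  moreover have "\<forall>x\<in>U. g differentiable (at x)" using hg unfolding differentiable_def by blast
  moreover have "derivs_satisfy U A k (\<lambda>x. frechet_derivative g (at x) v)" for v
  proof (rule Suc.IH)
    show "derivs_satisfy U A k (\<lambda>x. frechet_derivative f (at x) v)" using Suc.prems(1) by simp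
    show "frechet_derivative f (at x) v = frechet_derivative g (at x) v" if "x \<in> U" for x
      using frechet_derivative_eq[OF hg[OF that]] by simp
  qed
  ultimately show ?case by simp
qed

lemma derivs_satisfy_base: "derivs_satisfy U A k f \<Longrightarrow> A f"
  by (cases k) auto

lemma derivs_satisfy_Suc_lower: "derivs_satisfy U A (Suc k) f \<Longrightarrow> derivs_satisfy U A k f"
proof (induction k arbitrary: f)
  case (Suc k)
  have "derivs_satisfy U A k (\<lambda>x. frechet_derivative f (at x) v)" for v
    using Suc.prems by (intro Suc.IH) simp
  then show ?case using Suc.prems by simp
qed simp

lemma derivs_satisfy_SucI:
  assumes "open U" "depends_on U A" "A f"
    and "\<And>x. x \<in> U \<Longrightarrow> (f has_derivative F x) (at x)"
    and "\<And>v. derivs_satisfy U A k (\<lambda>x. F x v)"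
  shows "derivs_satisfy U A (Suc k) f"
proof -
  have "derivs_satisfy U A k (\<lambda>x. frechet_derivative f (at x) v)" for v
    by (rule derivs_satisfy_cong[OF assms(1,2) assms(5)[of v]])
      (simp add: frechet_derivative_eq[OF assms(4)])
  then show ?thesis using assms(3,4) by (auto simp: differentiable_def)
qed

lemma derivs_satisfy_SucD:
  assumes "derivs_satisfy U A (Suc k) f"
  shows "x \<in> U \<Longrightarrow> (f has_derivative frechet_derivative f (at x)) (at x)"
    and "derivs_satisfy U A k (\<lambda>x. frechet_derivative f (at x) v)"
  using assms by (auto simp: frechet_derivative_works)

lemma derivs_satisfy_mono:
  assumes "derivs_satisfy U A k f" "\<And>f. A f \<Longrightarrow> B f" "U' \<subseteq> U"
  shows "derivs_satisfy U' B k f"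
  using assms(1)
proof (induction k arbitrary: f)
  case 0
  then show ?case using assms(2) by simp
next
  case (Suc k)
  then show ?case using assms(2,3) by (simp add: subset_iff)
qed

lemma derivs_satisfy_add:
  assumes U: "open U" and C: "depends_on U C"
    and AB: "\<And>f g. A f \<Longrightarrow> B g \<Longrightarrow> C (\<lambda>x. f x + g x)"
    and "derivs_satisfy U A k f" "derivs_satisfy U B k g"
  shows "derivs_satisfy U C k (\<lambda>x. f x + g x)"
  using assms(4,5)
proof (induction k arbitrary: f g)
  case 0
  then show ?case using AB by simp
next
  case (Suc k)
  show ?case
  proof (rule derivs_satisfy_SucI[OF U C])
    show "C (\<lambda>x. f x + g x)" using Suc.prems by (auto intro: AB)
    show "((\<lambda>x. f x + g x) has_derivative
        (\<lambda>v. frechet_derivative f (at x) v + frechet_derivative g (at x) v)) (at x)" if "x \<in> U" for x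
      by (intro has_derivative_add derivs_satisfy_SucD(1)[OF Suc.prems(1) that]
          derivs_satisfy_SucD(1)[OF Suc.prems(2) that])
    show "derivs_satisfy U C k
        (\<lambda>x. frechet_derivative f (at x) v + frechet_derivative g (at x) v)" for v
      using Suc.prems by (intro Suc.IH) auto
  qed
qed

text \<open>
  Leibniz rule. Three predicates are needed because the product of functions of growth orders \<open>s\<close>
  and \<open>r\<close> has order \<open>s + r\<close>.
\<close>

lemma derivs_satisfy_mult:
  assumes U: "open U" and C: "depends_on U C"
    and AB: "\<And>f g. A f \<Longrightarrow> B g \<Longrightarrow> C (\<lambda>x. f x * g x)"
    and CC: "\<And>f g. C f \<Longrightarrow> C g \<Longrightarrow> C (\<lambda>x. f x + g x)"
    and "derivs_satisfy U A k f" "derivs_satisfy U B k g"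
  shows "derivs_satisfy U C k (\<lambda>x. f x * g x)"
  using assms(5,6)
proof (induction k arbitrary: f g)
  case 0
  then show ?case using AB by simp
next
  case (Suc k)
  show ?case
  proof (rule derivs_satisfy_SucI[OF U C])
    show "C (\<lambda>x. f x * g x)" using Suc.prems by (auto intro: AB)
    show "((\<lambda>x. f x * g x) has_derivative
        (\<lambda>v. f x * frechet_derivative g (at x) v + frechet_derivative f (at x) v * g x)) (at x)"
      if "x \<in> U" for x
      by (intro has_derivative_mult derivs_satisfy_SucD(1)[OF Suc.prems(1) that]
          derivs_satisfy_SucD(1)[OF Suc.prems(2) that])
    show "derivs_satisfy U C k
        (\<lambda>x. f x * frechet_derivative g (at x) v + frechet_derivative f (at x) v * g x)" for v
    proof (rule derivs_satisfy_add[OF U C CC])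
      show "derivs_satisfy U C k (\<lambda>x. f x * frechet_derivative g (at x) v)"
        by (rule Suc.IH[OF derivs_satisfy_Suc_lower[OF Suc.prems(1)]
              derivs_satisfy_SucD(2)[OF Suc.prems(2)]])
      show "derivs_satisfy U C k (\<lambda>x. frechet_derivative f (at x) v * g x)"
        by (rule Suc.IH[OF derivs_satisfy_SucD(2)[OF Suc.prems(1)]
              derivs_satisfy_Suc_lower[OF Suc.prems(2)]])
    qed
  qed
qed

abbreviation Ck_on :: "'a::euclidean_space set \<Rightarrow> nat \<Rightarrow> ('a \<Rightarrow> real) \<Rightarrow> bool" where
  "Ck_on U \<equiv> derivs_satisfy U (continuous_on U)"

definition smooth_on :: "'a::euclidean_space set \<Rightarrow> ('a \<Rightarrow> real) \<Rightarrow> bool" where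
  "smooth_on U f \<longleftrightarrow> (\<forall>k. Ck_on U k f)"

lemma depends_on_continuous: "depends_on U (continuous_on U)"
  unfolding depends_on_def using continuous_on_cong by metis

lemma Ck_eq_Ck_on: "Ck k f \<longleftrightarrow> Ck_on UNIV k f"
proof (induction k arbitrary: f)
  case (Suc k)
  have "continuous_on UNIV f" if "\<forall>x. f differentiable (at x)"
    using that differentiable_imp_continuous_on[of f UNIV]
    by (simp add: differentiable_on_def differentiable_at_withinI)
  then show ?case using Suc by auto
qed simp

lemma Csmooth_eq: "Csmooth f \<longleftrightarrow> smooth_on UNIV f"
  unfolding Csmooth_def smooth_on_def by (simp add: Ck_eq_Ck_on)

lemma Ck_on_SucI:
  assumes "open U" "\<And>x. x \<in> U \<Longrightarrow> (f has_derivative F x) (at x)"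
    and "\<And>v. Ck_on U k (\<lambda>x. F x v)"
  shows "Ck_on U (Suc k) f"
proof (rule derivs_satisfy_SucI[OF assms(1) depends_on_continuous _ assms(2,3)])
  show "continuous_on U f"
    using assms(1,2) by (meson continuous_at_imp_continuous_on has_derivative_continuous)
qed

lemma Ck_on_cong:
  assumes "open U" "Ck_on U k f" "\<And>x. x \<in> U \<Longrightarrow> f x = g x"
  shows "Ck_on U k g"
  using derivs_satisfy_cong[OF assms(1) depends_on_continuous assms(2,3)] .

lemma smooth_on_cong:
  assumes "open U" "smooth_on U f" "\<And>x. x \<in> U \<Longrightarrow> f x = g x"
  shows "smooth_on U g"
  unfolding smooth_on_def using Ck_on_cong[OF assms(1) _ assms(3)] assms(2)[unfolded smooth_on_def] by simp

lemma smooth_on_subset: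
  assumes "smooth_on U f" "V \<subseteq> U" shows "smooth_on V f"
proof -
  have "Ck_on V k f" if "Ck_on U k f" for k f
    using that
  proof (induction k arbitrary: f)
    case 0
    then show ?case using assms(2) continuous_on_subset by auto
  next
    case (Suc k)
    then show ?case using assms(2) continuous_on_subset[of U f V] by (simp add: subset_iff)
  qed
  then show ?thesis using assms(1) unfolding smooth_on_def by blast
qed

text \<open>
  Smooth functions are pieced together below from formulas that are valid only on overlapping open
  sets.
\<close>

lemma Ck_on_local:
  assumes U: "open U" and loc: "\<And>x. x \<in> U \<Longrightarrow> \<exists>V. open V \<and> x \<in> V \<and> Ck_on V k f"
  shows "Ck_on U k f"
  using loc
proof (induction k arbitrary: f)
  case 0
  have "isCont f x" if "x \<in> U" for x
    using 0[OF that] continuous_on_eq_continuous_at by auto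
  then show ?case by (simp add: continuous_at_imp_continuous_on)
next
  case (Suc k)
  show ?case
  proof (rule Ck_on_SucI[OF U])
    show "(f has_derivative frechet_derivative f (at x)) (at x)" if "x \<in> U" for x
    proof -
      obtain V where "x \<in> V" "Ck_on V (Suc k) f" using Suc.prems[OF \<open>x \<in> U\<close>] by blast
      then show ?thesis by (rule derivs_satisfy_SucD(1)[rotated])
    qed
    show "Ck_on U k (\<lambda>x. frechet_derivative f (at x) v)" for v
    proof (rule Suc.IH)
      show "\<exists>V. open V \<and> x \<in> V \<and> Ck_on V k (\<lambda>x. frechet_derivative f (at x) v)" if "x \<in> U" for x
        using Suc.prems[OF that] derivs_satisfy_SucD(2) by blast
    qed
  qed
qed

lemma smooth_on_local:
  assumes "open U" "\<And>x. x \<in> U \<Longrightarrow> \<exists>V. open V \<and> x \<in> V \<and> smooth_on V f"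
  shows "smooth_on U f"
  unfolding smooth_on_def
proof
  fix k show "Ck_on U k f"
  proof (rule Ck_on_local[OF assms(1)])
    show "\<exists>V. open V \<and> x \<in> V \<and> Ck_on V k f" if "x \<in> U" for x
      using assms(2)[OF that] unfolding smooth_on_def by blast
  qed
qed

lemma smooth_on_union:
  assumes "open U" "open V" "smooth_on U f" "smooth_on V f"
  shows "smooth_on (U \<union> V) f"
proof (rule smooth_on_local)
  show "\<exists>W. open W \<and> x \<in> W \<and> smooth_on W f" if "x \<in> U \<union> V" for x
    using that assms by blast
qed (simp add: assms open_Un)

lemma Ck_on_add: "open U \<Longrightarrow> Ck_on U k f \<Longrightarrow> Ck_on U k g \<Longrightarrow> Ck_on U k (\<lambda>x. f x + g x)"
  by (rule derivs_satisfy_add[OF _ depends_on_continuous]) (auto intro: continuous_intros)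

lemma Ck_on_mult: "open U \<Longrightarrow> Ck_on U k f \<Longrightarrow> Ck_on U k g \<Longrightarrow> Ck_on U k (\<lambda>x. f x * g x)"
  by (rule derivs_satisfy_mult[OF _ depends_on_continuous]) (auto intro: continuous_intros)

lemma Ck_on_const: "Ck_on U k (\<lambda>x. c)"
proof (induction k arbitrary: c)
  case (Suc k)
  then show ?case by (simp add: frechet_derivative_const)
qed simp

lemma Ck_on_linear:
  assumes "open U" "bounded_linear f" shows "Ck_on U k f"
proof (cases k)
  case 0
  then show ?thesis using assms by (simp add: linear_continuous_on)
next
  case (Suc m)
  show ?thesis unfolding Suc
    by (rule Ck_on_SucI[OF assms(1)], rule bounded_linear_imp_has_derivative[OF assms(2)])
      (rule Ck_on_const)
qed

text \<open>
  The outer function is the one that changes along the induction: the derivative of \<open>p \<circ> f\<close> is the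
  product of that of \<open>f\<close> with \<open>p' \<circ> f\<close>.
\<close>

lemma Ck_on_compose:
  fixes p :: "real \<Rightarrow> real"
  assumes W: "open W" and U: "open U" and fU: "\<And>x. x \<in> U \<Longrightarrow> f x \<in> W"
    and "Ck_on W k p" "Ck_on U k f"
  shows "Ck_on U k (\<lambda>x. p (f x))"
  using assms(4)
proof (insert assms(5), induction k arbitrary: p)
  case 0
  then show ?case using fU continuous_on_compose2[of W p U f] by auto
next
  case (Suc k)
  show ?case
  proof (rule Ck_on_SucI[OF U])
    show "((\<lambda>x. p (f x)) has_derivative
        (\<lambda>v. frechet_derivative f (at x) v * frechet_derivative p (at (f x)) 1)) (at x)"
      if "x \<in> U" for x
    proof -
      have p: "(p has_derivative frechet_derivative p (at (f x))) (at (f x))"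
        using derivs_satisfy_SucD(1)[OF Suc.prems(2) fU[OF that]] .
      have "((\<lambda>x. p (f x)) has_derivative
          (\<lambda>v. frechet_derivative p (at (f x)) (frechet_derivative f (at x) v))) (at x)"
        using has_derivative_compose[OF derivs_satisfy_SucD(1)[OF Suc.prems(1) that] p] .
      moreover have "(\<lambda>v. frechet_derivative p (at (f x)) (frechet_derivative f (at x) v)) =
          (\<lambda>v. frechet_derivative f (at x) v * frechet_derivative p (at (f x)) 1)"
        by (rule ext) (rule linear_scale[OF has_derivative_linear[OF p], of _ 1,
              unfolded real_scaleR_def mult_1_right])
      ultimately show ?thesis by (rule subst[rotated])
    qed
    show "Ck_on U k (\<lambda>x. frechet_derivative f (at x) v * frechet_derivative p (at (f x)) 1)" for v
      by (rule Ck_on_mult[OF U derivs_satisfy_SucD(2)[OF Suc.prems(1)]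
            Suc.IH[OF derivs_satisfy_Suc_lower[OF Suc.prems(1)] derivs_satisfy_SucD(2)[OF Suc.prems(2)]]])
  qed
qed

lemma smooth_on_add: "open U \<Longrightarrow> smooth_on U f \<Longrightarrow> smooth_on U g \<Longrightarrow> smooth_on U (\<lambda>x. f x + g x)"
  and smooth_on_mult: "open U \<Longrightarrow> smooth_on U f \<Longrightarrow> smooth_on U g \<Longrightarrow> smooth_on U (\<lambda>x. f x * g x)"
  and smooth_on_const: "smooth_on U (\<lambda>x. c)"
  and smooth_on_linear: "open U \<Longrightarrow> bounded_linear h \<Longrightarrow> smooth_on U h"
  unfolding smooth_on_def by (simp_all add: Ck_on_add Ck_on_mult Ck_on_const Ck_on_linear)

lemma smooth_on_compose:
  fixes p :: "real \<Rightarrow> real"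
  assumes "open W" "open U" "\<And>x. x \<in> U \<Longrightarrow> f x \<in> W" "smooth_on W p" "smooth_on U f"
  shows "smooth_on U (\<lambda>x. p (f x))"
  unfolding smooth_on_def using Ck_on_compose[OF assms(1,2), of f _ p] assms(3) assms(4,5)[unfolded smooth_on_def] by simp

lemma smooth_on_diff:
  assumes "open U" "smooth_on U f" "smooth_on U g" shows "smooth_on U (\<lambda>x. f x - g x)"
proof -
  have "smooth_on U (\<lambda>x. f x + (- 1) * g x)"
    by (intro smooth_on_add smooth_on_mult smooth_on_const assms)
  then show ?thesis by simp
qed

lemma smooth_on_power2:
  "open U \<Longrightarrow> smooth_on U f \<Longrightarrow> smooth_on U (\<lambda>x. (f x)\<^sup>2)"
  unfolding power2_eq_square by (rule smooth_on_mult)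

lemma smooth_on_sum:
  "open U \<Longrightarrow> (\<And>i. i \<in> I \<Longrightarrow> smooth_on U (f i)) \<Longrightarrow> smooth_on U (\<lambda>x. \<Sum>i\<in>I. f i x)"
  by (induction I rule: infinite_finite_induct) (auto intro: smooth_on_const smooth_on_add)

lemma smooth_on_inverse: "smooth_on (- {0}) (inverse :: real \<Rightarrow> real)"
proof -
  have "Ck_on (- {0::real}) k inverse" for k
  proof (induction k)
    case 0
    then show ?case by (auto intro!: continuous_intros)
  next
    case (Suc k)
    show ?case
    proof (rule Ck_on_SucI)
      show "((inverse :: real \<Rightarrow> real) has_derivative (\<lambda>v. inverse x * inverse x * (- v))) (at x)"
        if "x \<in> - {0}" for x :: real
        using that by (auto intro!: derivative_eq_intros)
      show "Ck_on (- {0::real}) k (\<lambda>x. inverse x * inverse x * (- v))" for v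
        by (intro Ck_on_mult Suc Ck_on_const) auto
    qed auto
  qed
  then show ?thesis unfolding smooth_on_def by blast
qed

lemma smooth_on_powr: "smooth_on {0<..} (\<lambda>x::real. x powr r)"
proof -
  have "Ck_on {0::real<..} k (\<lambda>x. x powr r)" for k
  proof (induction k arbitrary: r)
    case 0
    then show ?case by (auto intro!: continuous_intros)
  next
    case (Suc k)
    show ?case
    proof (rule Ck_on_SucI)
      show "((\<lambda>x::real. x powr r) has_derivative (\<lambda>v. r * x powr (r - 1) * v)) (at x)"
        if "x \<in> {0<..}" for x :: real
        using that has_real_derivative_powr[of x r] unfolding has_field_derivative_def by auto
      show "Ck_on {0::real<..} k (\<lambda>x. r * x powr (r - 1) * v)" for v
        by (intro Ck_on_mult Suc Ck_on_const) auto
    qed auto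
  qed
  then show ?thesis unfolding smooth_on_def by blast
qed

lemma derivative_sequence_Ck_on:
  fixes G :: "nat \<Rightarrow> real \<Rightarrow> real"
  assumes "\<And>i x. (G i has_real_derivative G (Suc i) x) (at x)"
  shows "Ck_on UNIV k (G i)"
proof (induction k arbitrary: i)
  case 0
  show ?case using assms[of i] by (auto intro: continuous_at_imp_continuous_on DERIV_isCont)
next
  case (Suc k)
  show ?case
  proof (rule Ck_on_SucI)
    show "(G i has_derivative (\<lambda>v. G (Suc i) x * v)) (at x)" for x
      using assms unfolding has_field_derivative_def by auto
    show "Ck_on UNIV k (\<lambda>x. G (Suc i) x * v)" for v
      by (intro Ck_on_mult Suc Ck_on_const) auto
  qed auto
qed

lemma smooth_on_cos: "smooth_on UNIV (cos :: real \<Rightarrow> real)"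
proof -
  have "((\<lambda>x. cos (x + real i * (pi/2))) has_real_derivative cos (x + real (Suc i) * (pi/2))) (at x)"
    for i x
  proof -
    have "cos (x + real (Suc i) * (pi/2)) = - sin (x + real i * (pi/2))"
      using minus_sin_cos_eq[of "x + real i * (pi/2)"] by (simp add: add_divide_distrib algebra_simps)
    then show ?thesis by (auto intro!: derivative_eq_intros)
  qed
  then have "Ck_on UNIV k (\<lambda>x. cos (x + real 0 * (pi/2)))" for k
    by (rule derivative_sequence_Ck_on)
  then show ?thesis unfolding smooth_on_def by simp
qed

text \<open>
  On the line, the interpolation argument handles all derivatives of a function at once, as a
  sequence in which each member is the derivative of its predecessor.
\<close>

lemma smooth_derivative_sequence:
  fixes f :: "real \<Rightarrow> real"
  assumes "smooth_on UNIV f"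
  shows "((deriv ^^ i) f has_real_derivative (deriv ^^ Suc i) f x) (at x)"
proof -
  have step: "smooth_on UNIV (deriv f) \<and> (f has_real_derivative deriv f x) (at x)"
    if f: "smooth_on UNIV f" for f :: "real \<Rightarrow> real" and x
  proof -
    have d: "f differentiable (at x)" for x
      using f[unfolded smooth_on_def, rule_format, of "Suc 0"] by simp
    then have dd: "(f has_real_derivative deriv f x) (at x)" for x
      using DERIV_deriv_iff_real_differentiable by blast
    then have "frechet_derivative f (at x) 1 = deriv f x" for x
      using frechet_derivative_eq[OF dd[of x, unfolded has_field_derivative_def]] by simp
    then have "(\<lambda>x. frechet_derivative f (at x) 1) = deriv f" by auto
    then have "Ck_on UNIV k (deriv f)" for k
      using derivs_satisfy_SucD(2)[OF f[unfolded smooth_on_def, rule_format, of "Suc k"], of 1] by simp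
    then show ?thesis using dd unfolding smooth_on_def by auto
  qed
  have "smooth_on UNIV ((deriv ^^ i) f)" by (induction i) (use assms step in auto)
  then show ?thesis using step by simp
qed

section \<open>Interpolation between the oscillation and high derivatives\<close>

text \<open>
  Replacing the sequence by its differences over a step \<open>h\<close> doubles the bound and trades one
  derivative for a division by \<open>h\<close>, by the mean value theorem; so the \<open>k\<close>-th difference quotient
  is attained by the \<open>k\<close>-th derivative somewhere in the interval.
\<close>

lemma finite_difference_mean_value:
  fixes G :: "nat \<Rightarrow> real \<Rightarrow> real"
  assumes "\<And>i x. (G i has_real_derivative G (Suc i) x) (at x)" and "h > 0"
    and "\<And>y. y \<in> {x..x + real k * h} \<Longrightarrow> \<bar>G 0 y\<bar> \<le> d"
  shows "\<exists>\<xi>\<in>{x..x + real k * h}. \<bar>G k \<xi>\<bar> \<le> (2 / h) ^ k * d"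
  using assms(1,3)
proof (induction k arbitrary: G d)
  case 0
  then show ?case by auto
next
  case (Suc k)
  define G' where "G' = (\<lambda>i y. G i (y + h) - G i y)"
  have "(G' i has_real_derivative G' (Suc i) y) (at y)" for i y
    unfolding G'_def
    by (intro DERIV_diff Suc.prems(1) DERIV_shift[THEN iffD1])
  moreover have "\<bar>G' 0 y\<bar> \<le> 2 * d" if "y \<in> {x..x + real k * h}" for y
  proof -
    have "y \<in> {x..x + real (Suc k) * h}" "y + h \<in> {x..x + real (Suc k) * h}"
      using that \<open>h > 0\<close> by (auto simp: algebra_simps)
    from Suc.prems(2)[OF this(1)] Suc.prems(2)[OF this(2)] show ?thesis unfolding G'_def by linarith
  qed
  ultimately obtain \<xi> where \<xi>: "\<xi> \<in> {x..x + real k * h}" "\<bar>G' k \<xi>\<bar> \<le> (2 / h) ^ k * (2 * d)"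
    using Suc.IH[of G' "2 * d"] by blast
  obtain z where z: "\<xi> < z" "z < \<xi> + h" "G k (\<xi> + h) - G k \<xi> = h * G (Suc k) z"
    using MVT2[of \<xi> "\<xi> + h" "G k" "G (Suc k)"] Suc.prems(1) \<open>h > 0\<close> by auto
  have "h * \<bar>G (Suc k) z\<bar> \<le> (2 / h) ^ k * (2 * d)"
    using \<xi>(2) z(3) \<open>h > 0\<close> unfolding G'_def by (simp add: abs_mult)
  then have "\<bar>G (Suc k) z\<bar> \<le> (2 / h) ^ Suc k * d"
    using \<open>h > 0\<close> by (simp add: field_simps)
  moreover have "z \<in> {x..x + real (Suc k) * h}"
    using \<xi>(1) z \<open>h > 0\<close> by (auto simp: algebra_simps)
  ultimately show ?case by blast
qed

text \<open>
  The finite difference argument finds a point within \<open>(k+1) h\<close> of \<open>y\<close> at which the derivative is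
  small, and one further derivative controls the way back to \<open>y\<close>. Only the oscillation matters
  since constants are killed by differentiation.
\<close>

lemma derivative_interpolation_step:
  fixes G :: "nat \<Rightarrow> real \<Rightarrow> real"
  assumes G: "\<And>i x. (G i has_real_derivative G (Suc i) x) (at x)"
    and h: "0 < h" "real (Suc k) * h \<le> (q - p) / 2"
    and d: "\<And>y z. y \<in> {p..q} \<Longrightarrow> z \<in> {p..q} \<Longrightarrow> \<bar>G 0 y - G 0 z\<bar> \<le> d"
    and B: "\<And>y. y \<in> {p..q} \<Longrightarrow> \<bar>G (Suc (Suc k)) y\<bar> \<le> B"
    and y: "y \<in> {p..q}"
  shows "\<bar>G (Suc k) y\<bar> \<le> (2 / h) ^ Suc k * d + real (Suc k) * h * B"
proof -
  define l where "l = real (Suc k) * h"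
  have l: "0 < l" "l \<le> (q - p) / 2" using h unfolding l_def by auto
  \<comment> \<open>The grid of step \<open>h\<close> is laid towards the farther end of the interval, where there is room for it.\<close>
  define x where "x = (if y \<le> (p + q) / 2 then y else y - l)"
  have sub: "{x..x + l} \<subseteq> {p..q}" and near: "\<bar>\<xi> - y\<bar> \<le> l" if "\<xi> \<in> {x..x + l}" for \<xi>
    using y l that unfolding x_def by (auto simp: field_simps split: if_splits)
  define H where "H = (\<lambda>i y. if i = 0 then G 0 y - G 0 x else G i y)"
  have xpq: "x \<in> {p..q}" using sub[of x] l(1) by auto
  have "\<exists>\<xi>\<in>{x..x + real (Suc k) * h}. \<bar>H (Suc k) \<xi>\<bar> \<le> (2 / h) ^ Suc k * d"
  proof (rule finite_difference_mean_value)
    show "(H i has_real_derivative H (Suc i) z) (at z)" for i z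
      using G[of i z] unfolding H_def by (cases i) (auto intro!: derivative_eq_intros)
    show "\<bar>H 0 z\<bar> \<le> d" if "z \<in> {x..x + real (Suc k) * h}" for z
      using d[of z x] sub[of z] that xpq unfolding H_def l_def by auto
  qed (rule h)
  then obtain \<xi> where \<xi>: "\<xi> \<in> {x..x + l}" "\<bar>G (Suc k) \<xi>\<bar> \<le> (2 / h) ^ Suc k * d"
    unfolding H_def l_def by auto
  have \<xi>pq: "\<xi> \<in> {p..q}" using \<xi>(1) sub by blast
  have "norm (G (Suc k) y - G (Suc k) \<xi>) \<le> B * norm (y - \<xi>)"
  proof (rule field_differentiable_bound[of "{p..q}"])
    show "(G (Suc k) has_field_derivative G (Suc (Suc k)) z) (at z within {p..q})" for z
      using G DERIV_subset by blast
    show "norm (G (Suc (Suc k)) z) \<le> B" if "z \<in> {p..q}" for z using B[OF that] by simp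
  qed (use y \<xi>pq in auto)
  also have "\<dots> \<le> B * l"
    using near[OF \<xi>(1)] B[OF y] by (intro mult_left_mono) (auto simp: abs_minus_commute)
  finally show ?thesis using \<xi>(2) unfolding l_def by (auto simp: algebra_simps)
qed

text \<open>
  A Landau--Kolmogorov type inequality: on an interval that is not too short compared with the
  oscillation \<open>d\<close>, every derivative is \<open>O(d\<^sup>p)\<close> with \<open>p\<close> as close to \<open>1\<close> as desired, the constant
  being independent of the interval. The interpolation step with \<open>h\<close> proportional to \<open>d\<^sup>\<eta>\<close> bounds
  the derivative of order \<open>k\<close> by \<open>d\<^bsup>1 - k \<eta>\<^esup>\<close> plus \<open>d\<^sup>\<eta>\<close> times the one of order \<open>k + 1\<close>. If all
  derivatives obey the bound with exponent \<open>min (n \<eta>) (1 - k \<eta>)\<close>, this improves \<open>n\<close> to \<open>n + 1\<close>;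
  for \<open>n \<eta> \<ge> 1\<close> and small \<open>\<eta>\<close> the exponent is close to \<open>1\<close>.
\<close>

lemma derivatives_bounded_by_oscillation:
  fixes G :: "nat \<Rightarrow> real \<Rightarrow> real"
  assumes G: "\<And>i x. (G i has_real_derivative G (Suc i) x) (at x)"
    and M: "\<And>i x. \<bar>G i x\<bar> \<le> M i"
    and pos: "0 < \<eta>" "0 < L"
  shows "\<exists>C. \<forall>p q d. p < q \<longrightarrow> 0 < d \<longrightarrow> d \<le> 1 \<longrightarrow> d powr \<eta> \<le> L * (q - p) \<longrightarrow>
      (\<forall>y\<in>{p..q}. \<forall>z\<in>{p..q}. \<bar>G 0 y - G 0 z\<bar> \<le> d) \<longrightarrow>
      (\<forall>y\<in>{p..q}. \<bar>G (Suc k) y\<bar> \<le> C * d powr min (real n * \<eta>) (1 - real (Suc k) * \<eta>))"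
proof (induction n arbitrary: k)
  case 0
  have M0: "0 \<le> M (Suc k)" using M[of "Suc k" 0] by linarith
  have "\<bar>G (Suc k) y\<bar> \<le> M (Suc k) * d powr min (real 0 * \<eta>) (1 - real (Suc k) * \<eta>)"
    if "0 < d" "d \<le> 1" for d y
  proof -
    have "1 = d powr 0" using that by simp
    also have "\<dots> \<le> d powr min (real 0 * \<eta>) (1 - real (Suc k) * \<eta>)"
      using that by (intro powr_mono') auto
    finally show ?thesis using M[of "Suc k" y] M0 mult_left_mono by fastforce
  qed
  then show ?case by blast
next
  case (Suc n)
  from Suc[of "Suc k"] obtain C where C: "\<And>p q d y. p < q \<Longrightarrow> 0 < d \<Longrightarrow> d \<le> 1 \<Longrightarrow>
      d powr \<eta> \<le> L * (q - p) \<Longrightarrow> (\<forall>y\<in>{p..q}. \<forall>z\<in>{p..q}. \<bar>G 0 y - G 0 z\<bar> \<le> d) \<Longrightarrow> y \<in> {p..q} \<Longrightarrow>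
      \<bar>G (Suc (Suc k)) y\<bar> \<le> C * d powr min (real n * \<eta>) (1 - real (Suc (Suc k)) * \<eta>)"
    by blast
  define K where "K = real (Suc k)"
  have K: "K > 0" unfolding K_def by simp
  \<comment> \<open>With this factor the whole grid of step \<open>h = c d\<^sup>\<eta>\<close> fits into half of the interval.\<close>
  define c where "c = 1 / (2 * K * L)"
  have c: "c > 0" unfolding c_def using K pos by simp
  define e where "e = min (real (Suc n) * \<eta>) (1 - K * \<eta>)"
  have "\<bar>G (Suc k) y\<bar> \<le> ((2 / c) ^ Suc k + K * c * \<bar>C\<bar>) * d powr e"
    if pq: "p < q" and d: "0 < d" "d \<le> 1" and dL: "d powr \<eta> \<le> L * (q - p)"
      and osc: "\<forall>y\<in>{p..q}. \<forall>z\<in>{p..q}. \<bar>G 0 y - G 0 z\<bar> \<le> d" and y: "y \<in> {p..q}" for p q d y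
  proof -
    define h where "h = c * d powr \<eta>"
    have h: "h > 0" unfolding h_def using c d by simp
    have "K * h = d powr \<eta> / (2 * L)" unfolding h_def c_def using K pos by (simp add: field_simps)
    also have "\<dots> \<le> (q - p) / 2" using dL pos by (simp add: field_simps)
    finally have Kh: "real (Suc k) * h \<le> (q - p) / 2" unfolding K_def .
    have "\<bar>G (Suc k) y\<bar> \<le> (2 / h) ^ Suc k * d +
        real (Suc k) * h * (\<bar>C\<bar> * d powr min (real n * \<eta>) (1 - real (Suc (Suc k)) * \<eta>))"
    proof (rule derivative_interpolation_step[of G, OF G h Kh _ _ y])
      show "\<bar>G 0 y - G 0 z\<bar> \<le> d" if "y \<in> {p..q}" "z \<in> {p..q}" for y z using osc that by blast
      show "\<bar>G (Suc (Suc k)) z\<bar> \<le> \<bar>C\<bar> * d powr min (real n * \<eta>) (1 - real (Suc (Suc k)) * \<eta>)"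
        if "z \<in> {p..q}" for z
        using C[OF pq d dL osc that] by (meson abs_ge_self mult_right_mono order_trans powr_ge_zero)
    qed
    also have "(2 / h) ^ Suc k * d = (2 / c) ^ Suc k * d powr (1 - K * \<eta>)"
    proof -
      have "(2 / h) ^ Suc k * d = (2 / c) ^ Suc k * (d / (d powr \<eta>) ^ Suc k)"
        unfolding h_def by (simp add: power_divide power_mult_distrib)
      also have "(d powr \<eta>) ^ Suc k = d powr (K * \<eta>)"
        using d powr_realpow[of "d powr \<eta>" "Suc k"] unfolding K_def
        by (simp add: powr_powr mult.commute)
      also have "d / d powr (K * \<eta>) = d powr (1 - K * \<eta>)" using d by (simp add: powr_diff)
      finally show ?thesis .
    qed
    also have "real (Suc k) * h * (\<bar>C\<bar> * d powr min (real n * \<eta>) (1 - real (Suc (Suc k)) * \<eta>)) =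
        K * c * \<bar>C\<bar> * d powr e"
    proof -
      have "d powr \<eta> * d powr min (real n * \<eta>) (1 - real (Suc (Suc k)) * \<eta>) = d powr e"
        unfolding e_def K_def powr_add[symmetric]
        by (rule arg_cong[where f = "\<lambda>s. d powr s"]) (auto simp: min_def algebra_simps)
      then show ?thesis unfolding h_def K_def by (simp add: mult_ac)
    qed
    also have "(2 / c) ^ Suc k * d powr (1 - K * \<eta>) \<le> (2 / c) ^ Suc k * d powr e"
      using c d unfolding e_def by (intro mult_left_mono powr_mono') auto
    finally show ?thesis by (simp add: algebra_simps)
  qed
  then show ?case unfolding e_def K_def by blast
qed

section \<open>Dilation increments of monotone profiles\<close>

text \<open>
  \<open>K 0\<close> stands for the squared radial profile \<open>\<alpha>\<^sup>2\<close>, with its derivatives \<open>K i\<close>. Its increment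
  over the segment from \<open>x\<close> to \<open>N x\<close> is its oscillation there, because it is monotone in \<open>\<bar>x\<bar>\<close>.
  The last condition says that this increment vanishes at \<open>0\<close> to infinite order, so that the
  segment, whose length shrinks like \<open>\<bar>x\<bar>\<close>, stays long compared with every power of the
  oscillation.
\<close>

locale dilation_profile =
  fixes K :: "nat \<Rightarrow> real \<Rightarrow> real" and N :: real and M :: "nat \<Rightarrow> real"
  assumes K_deriv: "\<And>i x. (K i has_real_derivative K (Suc i) x) (at x)"
    and K_bound: "\<And>i x. \<bar>K i x\<bar> \<le> M i"
    and K_range: "\<And>x. 0 \<le> K 0 x" "\<And>x. K 0 x \<le> 1"
    and K_decreasing: "\<And>x y. \<bar>x\<bar> \<le> \<bar>y\<bar> \<Longrightarrow> K 0 y \<le> K 0 x"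
    and N: "1 < N"
    and K_flat: "\<And>q. 0 < q \<Longrightarrow> \<exists>C. \<forall>x. (K 0 x - K 0 (N * x)) powr q \<le> C * \<bar>x\<bar>"
begin

definition D :: "nat \<Rightarrow> real \<Rightarrow> real" where
  "D i x = K i x - N ^ i * K i (N * x)"

lemma D_deriv: "(D i has_real_derivative D (Suc i) x) (at x)"
proof -
  have "((\<lambda>x. K i (N * x)) has_real_derivative K (Suc i) (N * x) * N) (at x)"
    by (rule DERIV_chain2[OF K_deriv]) (auto intro!: derivative_eq_intros)
  then have "((\<lambda>x. K i x - N ^ i * K i (N * x)) has_real_derivative
      K (Suc i) x - N ^ i * (K (Suc i) (N * x) * N)) (at x)"
    by (intro DERIV_diff K_deriv DERIV_cmult)
  then show ?thesis unfolding D_def by (simp add: mult_ac)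
qed

lemma D_nonneg: "0 \<le> D 0 x"
proof -
  have "\<bar>x\<bar> \<le> \<bar>N * x\<bar>" using N by (simp add: abs_mult mult_le_cancel_right1)
  then show ?thesis unfolding D_def using K_decreasing by simp
qed

lemma D_le_1: "D 0 x \<le> 1"
  unfolding D_def using K_range[of x] K_range[of "N * x"] by simp

lemma D_flat_at_0: "0 < q \<Longrightarrow> \<exists>C. \<forall>x. D 0 x powr q \<le> C * \<bar>x\<bar>"
  using K_flat unfolding D_def by simp

text \<open>
  The endpoints \<open>x\<close> and \<open>N x\<close> lie on the segment over which \<open>D 0 x\<close> is the oscillation. Where
  \<open>D 0 x = 0\<close>, the inequality is applied with arbitrarily small \<open>d > 0\<close> instead.
\<close>

lemma K_derivs_bound:
  assumes p: "0 < p" "p < 1"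
  shows "\<exists>C. \<forall>x. \<bar>K (Suc k) x\<bar> \<le> C * D 0 x powr p \<and> \<bar>K (Suc k) (N * x)\<bar> \<le> C * D 0 x powr p"
proof -
  \<comment> \<open>This makes the exponent \<open>1 - (k+1) \<eta>\<close> equal to \<open>p\<close>.\<close>
  define \<eta> where "\<eta> = (1 - p) / real (Suc k)"
  have \<eta>: "\<eta> > 0" unfolding \<eta>_def using p by simp
  obtain n where n: "1 < real n * \<eta>" using reals_Archimedean3[OF \<eta>] by blast
  obtain A where A: "\<And>x. D 0 x powr \<eta> \<le> A * \<bar>x\<bar>" using D_flat_at_0[OF \<eta>] by blast
  define L where "L = (\<bar>A\<bar> + 1) / (N - 1)"
  have L: "L > 0" unfolding L_def using N by (simp add: add_nonneg_pos)
  obtain C where C: "\<And>p q d y. p < q \<Longrightarrow> 0 < d \<Longrightarrow> d \<le> 1 \<Longrightarrow> d powr \<eta> \<le> L * (q - p) \<Longrightarrow>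
      (\<forall>y\<in>{p..q}. \<forall>z\<in>{p..q}. \<bar>K 0 y - K 0 z\<bar> \<le> d) \<Longrightarrow> y \<in> {p..q} \<Longrightarrow>
      \<bar>K (Suc k) y\<bar> \<le> C * d powr min (real n * \<eta>) (1 - real (Suc k) * \<eta>)"
    using derivatives_bounded_by_oscillation[of K M, OF K_deriv K_bound \<eta> L, of k n] by blast
  have min_eq: "min (real n * \<eta>) (1 - real (Suc k) * \<eta>) = p"
  proof -
    have "real (Suc k) * \<eta> = 1 - p" unfolding \<eta>_def by simp
    then show ?thesis using n p by (simp only:)
  qed
  have seg: "\<bar>K (Suc k) y\<bar> \<le> C * d powr p"
    if x: "x \<noteq> 0" and d: "D 0 x \<le> d" "0 < d" "d \<le> 1" "d powr \<eta> \<le> (\<bar>A\<bar> + 1) * \<bar>x\<bar>"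
      and y: "y = x \<or> y = N * x" for x d y
  proof -
    define l r where "l = min x (N * x)" and "r = max x (N * x)"
    have rl: "r - l = (N - 1) * \<bar>x\<bar>"
      using N x unfolding l_def r_def by (cases "x > 0") (auto simp: min_def max_def algebra_simps)
    have "0 < r - l" unfolding rl using N x by simp
    moreover have "L * (r - l) = (\<bar>A\<bar> + 1) * \<bar>x\<bar>" unfolding rl L_def using N by simp
    ultimately have len: "L * (r - l) = (\<bar>A\<bar> + 1) * \<bar>x\<bar>" "l < r" by simp_all
    have rng: "K 0 (N * x) \<le> K 0 z \<and> K 0 z \<le> K 0 x" if "z \<in> {l..r}" for z
    proof -
      have "\<bar>x\<bar> \<le> \<bar>z\<bar> \<and> \<bar>z\<bar> \<le> \<bar>N * x\<bar>"
      proof (cases "x > 0")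
        case True
        then have "x \<le> N * x" using N by simp
        then show ?thesis using that True unfolding l_def r_def by auto
      next
        case False
        then have "N * x \<le> x" using N mult_right_mono_neg[of 1 N x] by simp
        then show ?thesis using that False unfolding l_def r_def by auto
      qed
      then show ?thesis using K_decreasing by blast
    qed
    have osc: "\<forall>y\<in>{l..r}. \<forall>z\<in>{l..r}. \<bar>K 0 y - K 0 z\<bar> \<le> d"
    proof (intro ballI)
      fix y z assume "y \<in> {l..r}" "z \<in> {l..r}"
      from rng[OF this(1)] rng[OF this(2)] show "\<bar>K 0 y - K 0 z\<bar> \<le> d"
        using d(1) unfolding D_def by auto
    qed
    have "y \<in> {l..r}" using y unfolding l_def r_def by auto
    from C[OF len(2) d(2,3) _ osc this] show ?thesis using len(1) d(4) min_eq by simp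
  qed
  have nz: "\<bar>K (Suc k) y\<bar> \<le> C * D 0 x powr p" if x: "x \<noteq> 0" and y: "y = x \<or> y = N * x" for x y
  proof (cases "D 0 x = 0")
    case False
    have "A * \<bar>x\<bar> \<le> (\<bar>A\<bar> + 1) * \<bar>x\<bar>" by (intro mult_right_mono) auto
    then show ?thesis
      using seg[OF x, of "D 0 x" y] y A[of x] D_nonneg[of x] D_le_1[of x] False by linarith
  next
    case True
    have t: "((\<lambda>d. d powr s) \<longlongrightarrow> 0) (at_right (0::real))" if "s > 0" for s
      by (rule tendsto_zero_powrI[OF tendsto_ident_at tendsto_const _ that])
        (auto simp: eventually_at_filter)
    have "\<forall>\<^sub>F d in at_right (0::real). d powr \<eta> < (\<bar>A\<bar> + 1) * \<bar>x\<bar>"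
      using order_tendstoD(2)[OF t[OF \<eta>], of "(\<bar>A\<bar> + 1) * \<bar>x\<bar>"] x by simp
    moreover have "\<forall>\<^sub>F d in at_right (0::real). 0 < d \<and> d < 1"
      using eventually_at_right_real[of 0 1] by simp
    ultimately have "\<forall>\<^sub>F d in at_right (0::real). \<bar>K (Suc k) y\<bar> \<le> C * d powr p"
    proof eventually_elim
      case (elim d)
      then show ?case using seg[OF x, of d y] y True by simp
    qed
    moreover have "((\<lambda>d. C * d powr p) \<longlongrightarrow> C * 0) (at_right (0::real))"
      by (intro tendsto_intros t p)
    ultimately have "\<bar>K (Suc k) y\<bar> \<le> C * 0"
      by (intro tendsto_lowerbound) auto
    then show ?thesis using True by simp
  qed
  have z: "K (Suc k) 0 = 0"
  proof -
    have D0: "D 0 0 = 0" unfolding D_def by simp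
    have "((\<lambda>x. \<bar>K (Suc k) x\<bar>) \<longlongrightarrow> \<bar>K (Suc k) 0\<bar>) (at 0)"
      using DERIV_isCont[OF K_deriv[of "Suc k" 0]] by (intro tendsto_rabs) (simp add: isCont_def)
    moreover have "((\<lambda>x. C * D 0 x powr p) \<longlongrightarrow> C * 0) (at 0)"
    proof (intro tendsto_mult tendsto_const tendsto_zero_powrI)
      show "(D 0 \<longlongrightarrow> 0) (at 0)"
        using DERIV_isCont[OF D_deriv[of 0 0]] D0 by (simp add: isCont_def)
      show "((\<lambda>x. p) \<longlongrightarrow> p) (at (0::real))" by simp
    qed (use p D_nonneg in auto)
    moreover have "\<forall>\<^sub>F x in at 0. \<bar>K (Suc k) x\<bar> \<le> C * D 0 x powr p"
      using nz by (auto simp: eventually_at_filter)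
    ultimately have "\<bar>K (Suc k) 0\<bar> \<le> C * 0"
      by (intro tendsto_le[of "at (0::real)"]) auto
    then show ?thesis by simp
  qed
  have "\<bar>K (Suc k) x\<bar> \<le> C * D 0 x powr p \<and> \<bar>K (Suc k) (N * x)\<bar> \<le> C * D 0 x powr p" for x
  proof (cases "x = 0")
    case True
    then show ?thesis using z unfolding D_def by simp
  next
    case False
    then show ?thesis using nz by blast
  qed
  then show ?thesis by blast
qed

lemma D_derivs_bound:
  assumes p: "0 < p" "p < 1"
  shows "\<exists>C. \<forall>x. \<bar>D i x\<bar> \<le> C * D 0 x powr p"
proof (cases i)
  case 0
  have "\<bar>D 0 x\<bar> \<le> 1 * D 0 x powr p" for x
  proof (cases "D 0 x = 0")
    case False
    then have "D 0 x powr 1 \<le> D 0 x powr p"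
      using D_nonneg[of x] D_le_1[of x] p by (intro powr_mono') auto
    then show ?thesis using D_nonneg[of x] False by simp
  qed simp
  then show ?thesis using 0 by blast
next
  case (Suc k)
  obtain C where C: "\<And>x. \<bar>K (Suc k) x\<bar> \<le> C * D 0 x powr p"
      "\<And>x. \<bar>K (Suc k) (N * x)\<bar> \<le> C * D 0 x powr p"
    using K_derivs_bound[OF p] by blast
  have "\<bar>D i x\<bar> \<le> (C + N ^ i * C) * D 0 x powr p" for x
  proof -
    have "\<bar>D i x\<bar> \<le> \<bar>K i x\<bar> + N ^ i * \<bar>K i (N * x)\<bar>"
      unfolding D_def using N abs_triangle_ineq4[of "K i x" "N ^ i * K i (N * x)"]
      by (simp add: abs_mult)
    also have "\<dots> \<le> C * D 0 x powr p + N ^ i * (C * D 0 x powr p)"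
      using C N unfolding Suc by (intro add_mono mult_left_mono) auto
    finally show ?thesis by (simp add: algebra_simps)
  qed
  then show ?thesis by blast
qed

text \<open>
  The bound \<open>\<bar>D'\<bar> \<le> C D\<^bsup>1 - r\<^esup>\<close> makes \<open>D\<^sup>r\<close> Lipschitz near a zero. To avoid differentiating \<open>D\<^sup>r\<close>
  where \<open>D\<close> vanishes, the mean value theorem is applied up to a point \<open>y\<close> where \<open>D\<close> is maximal on
  the segment.
\<close>

lemma D_flat_at_zeros:
  assumes q: "0 < q"
  shows "\<exists>C. \<forall>x x0. D 0 x0 = 0 \<longrightarrow> D 0 x powr q \<le> C * \<bar>x - x0\<bar>"
proof -
  define r where "r = min q (1/2)"
  have r: "0 < r" "r < 1" "r \<le> q" using q unfolding r_def by auto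
  obtain C where C: "\<And>x. \<bar>D (Suc 0) x\<bar> \<le> C * D 0 x powr (1 - r)"
    using D_derivs_bound[of "1 - r" "Suc 0"] r by auto
  have "D 0 x powr q \<le> \<bar>C\<bar> * \<bar>x - x0\<bar>" if x0: "D 0 x0 = 0" for x x0
  proof (cases "D 0 x = 0")
    case True
    then show ?thesis by simp
  next
    case False
    have "\<exists>y\<in>closed_segment x0 x. \<forall>z\<in>closed_segment x0 x. D 0 z \<le> D 0 y"
    proof (rule continuous_attains_sup)
      show "continuous_on (closed_segment x0 x) (D 0)"
        using D_deriv DERIV_isCont continuous_at_imp_continuous_on by blast
    qed auto
    then obtain y where y: "y \<in> closed_segment x0 x"
        "\<And>z. z \<in> closed_segment x0 x \<Longrightarrow> D 0 z \<le> D 0 y" by blast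
    have Dy: "0 < D 0 y" "D 0 x \<le> D 0 y" using y(2)[of x] False D_nonneg[of x] by auto
    have sub: "closed_segment x0 y \<subseteq> closed_segment x0 x"
      using y(1) by (simp add: subset_closed_segment)
    have "norm (D 0 y - D 0 x0) \<le> (\<bar>C\<bar> * D 0 y powr (1 - r)) * norm (y - x0)"
    proof (rule field_differentiable_bound[of "closed_segment x0 y"])
      show "(D 0 has_field_derivative D (Suc 0) z) (at z within closed_segment x0 y)" for z
        using D_deriv DERIV_subset by blast
      show "norm (D (Suc 0) z) \<le> \<bar>C\<bar> * D 0 y powr (1 - r)" if "z \<in> closed_segment x0 y" for z
      proof -
        have "\<bar>D (Suc 0) z\<bar> \<le> \<bar>C\<bar> * D 0 z powr (1 - r)"
          using C[of z] by (meson abs_ge_self mult_right_mono order_trans powr_ge_zero)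
        also have "\<dots> \<le> \<bar>C\<bar> * D 0 y powr (1 - r)"
          using y(2)[of z] sub that D_nonneg[of z] r by (intro mult_left_mono powr_mono2) auto
        finally show ?thesis by simp
      qed
    qed auto
    also have "\<dots> \<le> (\<bar>C\<bar> * D 0 y powr (1 - r)) * \<bar>x - x0\<bar>"
      using y(1) by (intro mult_left_mono) (auto simp: closed_segment_eq_real_ivl split: if_splits)
    finally have "D 0 y \<le> D 0 y powr (1 - r) * (\<bar>C\<bar> * \<bar>x - x0\<bar>)"
      using x0 Dy by (simp add: mult_ac)
    moreover have "D 0 y = D 0 y powr (1 - r) * D 0 y powr r"
      using Dy by (simp add: powr_add[symmetric])
    ultimately have "D 0 y powr r \<le> \<bar>C\<bar> * \<bar>x - x0\<bar>"
      using Dy by (metis mult_le_cancel_left_pos powr_gt_zero less_irrefl)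
    moreover have "D 0 x powr q \<le> D 0 x powr r"
      using r D_nonneg[of x] D_le_1[of x] False by (intro powr_mono') auto
    moreover have "D 0 x powr r \<le> D 0 y powr r"
      using Dy D_nonneg r by (intro powr_mono2) auto
    ultimately show ?thesis by linarith
  qed
  then show ?thesis by blast
qed

end

section \<open>Functions controlled by powers of a flat weight\<close>

text \<open>
  The condition on the zeros of \<open>S\<close> says that \<open>S\<close> vanishes there to infinite order; in this form
  it can be used with real powers directly.
\<close>

locale flat_weight =
  fixes V :: "'a::euclidean_space set" and S :: "'a \<Rightarrow> real"
  assumes V: "open V" and S_cont: "continuous_on V S"
    and S_range: "\<And>x. x \<in> V \<Longrightarrow> 0 \<le> S x" "\<And>x. x \<in> V \<Longrightarrow> S x \<le> 1"
    and S_flat: "\<And>x0 q. x0 \<in> V \<Longrightarrow> S x0 = 0 \<Longrightarrow> 0 < q \<Longrightarrow>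
      \<exists>C. \<forall>x\<in>V. S x powr q \<le> C * norm (x - x0)"
begin

definition "pos = {x \<in> V. 0 < S x}"

text \<open>
  Growth of order \<open>s\<close>: the function is \<open>O(S\<^sup>p)\<close> for every \<open>p < s\<close>, locally up to the zeros of \<open>S\<close>.
  The strict inequality absorbs the losses of the interpolation inequality and, as \<open>S\<close> is flat,
  also any power of the distance to a zero. Functions all of whose derivatives have order \<open>s\<close> are
  called tame; orders add up under multiplication, and differentiation does not change the order.
\<close>

definition power_bound :: "real \<Rightarrow> ('a \<Rightarrow> real) \<Rightarrow> bool" where
  "power_bound s f \<longleftrightarrow> (\<forall>p<s. \<forall>x0\<in>V. \<exists>C. \<forall>\<^sub>F x in nhds x0. x \<in> pos \<longrightarrow> \<bar>f x\<bar> \<le> C * S x powr p)"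

abbreviation tame :: "real \<Rightarrow> nat \<Rightarrow> ('a \<Rightarrow> real) \<Rightarrow> bool" where
  "tame s \<equiv> derivs_satisfy pos (power_bound s)"

lemma open_pos: "open pos"
proof -
  have "pos = V \<inter> S -` {0<..}" unfolding pos_def by auto
  then show ?thesis using continuous_open_preimage[OF S_cont V] by simp
qed

lemma depends_on_power_bound: "depends_on pos (power_bound s)"
  unfolding depends_on_def
proof (intro allI impI)
  fix f g assume f: "power_bound s f" and eq: "\<forall>x\<in>pos. f x = g x"
  have "(x \<in> pos \<longrightarrow> \<bar>f x\<bar> \<le> C * S x powr p) = (x \<in> pos \<longrightarrow> \<bar>g x\<bar> \<le> C * S x powr p)" for x C p
    using eq by auto
  then show "power_bound s g" using f unfolding power_bound_def by simp
qed

lemma power_bound_add: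
  assumes "power_bound s f" "power_bound s g" shows "power_bound s (\<lambda>x. f x + g x)"
  unfolding power_bound_def
proof (intro allI impI ballI)
  fix p x0 assume px: "p < s" "x0 \<in> V"
  obtain C where C: "\<forall>\<^sub>F x in nhds x0. x \<in> pos \<longrightarrow> \<bar>f x\<bar> \<le> C * S x powr p"
    using assms(1) px unfolding power_bound_def by blast
  obtain C' where C': "\<forall>\<^sub>F x in nhds x0. x \<in> pos \<longrightarrow> \<bar>g x\<bar> \<le> C' * S x powr p"
    using assms(2) px unfolding power_bound_def by blast
  have "\<forall>\<^sub>F x in nhds x0. x \<in> pos \<longrightarrow> \<bar>f x + g x\<bar> \<le> (C + C') * S x powr p"
    using C C' by eventually_elim (auto simp: algebra_simps)
  then show "\<exists>C. \<forall>\<^sub>F x in nhds x0. x \<in> pos \<longrightarrow> \<bar>f x + g x\<bar> \<le> C * S x powr p" by blast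
qed

lemma power_bound_mult:
  assumes "power_bound s f" "power_bound r g" shows "power_bound (s + r) (\<lambda>x. f x * g x)"
  unfolding power_bound_def
proof (intro allI impI ballI)
  fix p x0 assume p: "p < s + r" and x0: "x0 \<in> V"
  define \<delta> where "\<delta> = (s + r - p) / 2"
  have \<delta>: "s - \<delta> < s" "r - \<delta> < r" "p = (s - \<delta>) + (r - \<delta>)" using p unfolding \<delta>_def by auto
  obtain C where C: "\<forall>\<^sub>F x in nhds x0. x \<in> pos \<longrightarrow> \<bar>f x\<bar> \<le> C * S x powr (s - \<delta>)"
    using assms(1) \<delta>(1) x0 unfolding power_bound_def by blast
  obtain C' where C': "\<forall>\<^sub>F x in nhds x0. x \<in> pos \<longrightarrow> \<bar>g x\<bar> \<le> C' * S x powr (r - \<delta>)"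
    using assms(2) \<delta>(2) x0 unfolding power_bound_def by blast
  have "\<forall>\<^sub>F x in nhds x0. x \<in> pos \<longrightarrow> \<bar>f x * g x\<bar> \<le> (C * C') * S x powr p"
    using C C'
  proof eventually_elim
    case (elim x)
    show ?case
    proof
      assume x: "x \<in> pos"
      have "\<bar>f x * g x\<bar> \<le> (C * S x powr (s - \<delta>)) * (C' * S x powr (r - \<delta>))"
        unfolding abs_mult using elim x by (intro mult_mono) (auto intro: order_trans[OF abs_ge_zero])
      also have "\<dots> = (C * C') * S x powr p"
        unfolding \<delta>(3) powr_add by (simp add: mult_ac)
      finally show "\<bar>f x * g x\<bar> \<le> (C * C') * S x powr p" .
    qed
  qed
  then show "\<exists>C. \<forall>\<^sub>F x in nhds x0. x \<in> pos \<longrightarrow> \<bar>f x * g x\<bar> \<le> C * S x powr p" by blast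
qed

lemma tame_add: "tame s k f \<Longrightarrow> tame s k g \<Longrightarrow> tame s k (\<lambda>x. f x + g x)"
  by (rule derivs_satisfy_add[OF open_pos depends_on_power_bound power_bound_add])

lemma tame_mult: "tame s k f \<Longrightarrow> tame r k g \<Longrightarrow> tame (s + r) k (\<lambda>x. f x * g x)"
  by (rule derivs_satisfy_mult[OF open_pos depends_on_power_bound power_bound_mult power_bound_add])

lemma tame_cong: "tame s k f \<Longrightarrow> (\<And>x. x \<in> pos \<Longrightarrow> f x = g x) \<Longrightarrow> tame s k g"
  by (rule derivs_satisfy_cong[OF open_pos depends_on_power_bound])

lemma one_le_powr:
  assumes "x \<in> pos" "p \<le> 0" shows "1 \<le> S x powr p"
  using powr_mono'[of p 0 "S x"] assms S_range unfolding pos_def by auto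

text \<open>
  Negative powers of \<open>S \<le> 1\<close> are at least \<open>1\<close>, so locally bounded functions have order \<open>0\<close>.
\<close>

lemma smooth_imp_tame:
  assumes "smooth_on V f" shows "tame 0 k f"
proof (rule derivs_satisfy_mono)
  show "Ck_on V k f" using assms unfolding smooth_on_def by blast
  show "power_bound 0 f" if f: "continuous_on V f" for f
    unfolding power_bound_def
  proof (intro allI impI ballI)
    fix p :: real and x0 assume p: "p < 0" and x0: "x0 \<in> V"
    have "(f \<longlongrightarrow> f x0) (nhds x0)"
      using f x0 V by (metis continuous_on_eq_continuous_at isCont_def tendsto_at_iff_tendsto_nhds)
    then have "((\<lambda>x. \<bar>f x\<bar>) \<longlongrightarrow> \<bar>f x0\<bar>) (nhds x0)" by (rule tendsto_rabs)
    then have "\<forall>\<^sub>F x in nhds x0. \<bar>f x\<bar> < \<bar>f x0\<bar> + 1" by (rule order_tendstoD) simp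
    then have "\<forall>\<^sub>F x in nhds x0. x \<in> pos \<longrightarrow> \<bar>f x\<bar> \<le> (\<bar>f x0\<bar> + 1) * S x powr p"
    proof eventually_elim
      case (elim x)
      show ?case
      proof
        assume "x \<in> pos"
        from one_le_powr[OF this, of p] have "(\<bar>f x0\<bar> + 1) * 1 \<le> (\<bar>f x0\<bar> + 1) * S x powr p"
          using p by (intro mult_left_mono) auto
        then show "\<bar>f x\<bar> \<le> (\<bar>f x0\<bar> + 1) * S x powr p" using elim by simp
      qed
    qed
    then show "\<exists>C. \<forall>\<^sub>F x in nhds x0. x \<in> pos \<longrightarrow> \<bar>f x\<bar> \<le> C * S x powr p" by blast
  qed
  show "pos \<subseteq> V" unfolding pos_def by auto
qed

lemma tame_smooth_mult:
  assumes "tame s k f" "smooth_on V g" shows "tame s k (\<lambda>x. f x * g x)"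
  using tame_mult[OF assms(1) smooth_imp_tame[OF assms(2)]] by simp

text \<open>
  The derivative of \<open>S\<^sup>r\<close> is \<open>r S\<^bsup>r - 1\<^esup> S'\<close>, of order \<open>(r - 1) + 1\<close>. This is where the bound by
  almost the first power of \<open>S\<close> on all its derivatives pays off; \<open>r\<close> has to be arbitrary for the
  induction.
\<close>

lemma tame_powr:
  assumes S: "tame 1 k S" shows "tame r k (\<lambda>x. S x powr r)"
  using S
proof (induction k arbitrary: r)
  have pb: "power_bound r (\<lambda>x. S x powr r)" for r
    unfolding power_bound_def
  proof (intro allI impI ballI)
    fix p x0 assume p: "p < r"
    have "\<bar>S x powr r\<bar> \<le> 1 * S x powr p" if "x \<in> pos" for x
      using that p powr_mono'[of p r "S x"] S_range unfolding pos_def by auto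
    then show "\<exists>C. \<forall>\<^sub>F x in nhds x0. x \<in> pos \<longrightarrow> \<bar>S x powr r\<bar> \<le> C * S x powr p"
      by (intro exI[of _ 1]) auto
  qed
  {
    case 0
    then show ?case using pb by simp
  next
    case (Suc k)
    show ?case
    proof (rule derivs_satisfy_SucI[of pos "power_bound r" "\<lambda>x. S x powr r"
          "\<lambda>x v. S x powr (r - 1) * frechet_derivative S (at x) v * r",
          OF open_pos depends_on_power_bound pb])
      show "((\<lambda>x. S x powr r) has_derivative
          (\<lambda>v. S x powr (r - 1) * frechet_derivative S (at x) v * r)) (at x)" if x: "x \<in> pos" for x
      proof -
        have "((\<lambda>s. s powr r) has_derivative (\<lambda>v. r * S x powr (r - 1) * v)) (at (S x))"
          using has_real_derivative_powr[of "S x" r] x unfolding has_field_derivative_def pos_def by auto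
        from has_derivative_compose[OF derivs_satisfy_SucD(1)[OF Suc.prems x] this]
        show ?thesis by (simp add: mult_ac)
      qed
      show "tame r k (\<lambda>x. S x powr (r - 1) * frechet_derivative S (at x) v * r)" for v
      proof (rule tame_smooth_mult[OF _ smooth_on_const])
        show "tame r k (\<lambda>x. S x powr (r - 1) * frechet_derivative S (at x) v)"
          using tame_mult[OF Suc.IH[OF derivs_satisfy_Suc_lower[OF Suc.prems], of "r - 1"]
              derivs_satisfy_SucD(2)[OF Suc.prems], of v] by simp
      qed
    qed
  }
qed

lemma tame_linear_compose:
  fixes G :: "nat \<Rightarrow> real \<Rightarrow> real"
  assumes G: "\<And>i x. (G i has_real_derivative G (Suc i) x) (at x)"
    and bound: "\<And>i p. 0 < p \<Longrightarrow> p < 1 \<Longrightarrow> \<exists>C. \<forall>x. \<bar>G i x\<bar> \<le> C * d x powr p"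
    and d: "\<And>x. 0 \<le> d x" and dS: "\<And>x. x \<in> V \<Longrightarrow> d (l x) \<le> S x"
    and l: "bounded_linear l"
  shows "tame 1 k (\<lambda>x. G i (l x))"
proof (induction k arbitrary: i)
  have pb: "power_bound 1 (\<lambda>x. G i (l x))" for i
    unfolding power_bound_def
  proof (intro allI impI ballI)
    fix p :: real and x0 assume p: "p < 1"
    \<comment> \<open>Monotonicity in the weight needs a positive exponent.\<close>
    define p' where "p' = max p (1/2)"
    have p': "0 < p'" "p' < 1" "p \<le> p'" using p unfolding p'_def by auto
    obtain C where C: "\<And>x. \<bar>G i x\<bar> \<le> C * d x powr p'" using bound[OF p'(1,2)] by blast
    have "\<bar>G i (l x)\<bar> \<le> \<bar>C\<bar> * S x powr p" if x: "x \<in> pos" for x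
    proof -
      have "\<bar>G i (l x)\<bar> \<le> \<bar>C\<bar> * d (l x) powr p'"
        using C[of "l x"] by (meson abs_ge_self mult_right_mono order_trans powr_ge_zero)
      also have "\<dots> \<le> \<bar>C\<bar> * S x powr p'"
        using x d dS p' unfolding pos_def by (intro mult_left_mono powr_mono2) auto
      also have "\<dots> \<le> \<bar>C\<bar> * S x powr p"
        using x S_range p' unfolding pos_def by (intro mult_left_mono powr_mono') auto
      finally show ?thesis .
    qed
    then show "\<exists>C. \<forall>\<^sub>F x in nhds x0. x \<in> pos \<longrightarrow> \<bar>G i (l x)\<bar> \<le> C * S x powr p"
      by (intro exI[of _ "\<bar>C\<bar>"]) auto
  qed
  {
    case 0
    then show ?case using pb by simp
  next
    case (Suc k)
    show ?case
    proof (rule derivs_satisfy_SucI[of pos "power_bound 1" "\<lambda>x. G i (l x)"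
          "\<lambda>x v. G (Suc i) (l x) * l v", OF open_pos depends_on_power_bound pb[of i]])
      show "((\<lambda>x. G i (l x)) has_derivative (\<lambda>v. G (Suc i) (l x) * l v)) (at x)"
        if "x \<in> pos" for x
        using has_derivative_compose[of l l x UNIV "G i" "\<lambda>v. G (Suc i) (l x) * v"]
          bounded_linear_imp_has_derivative[OF l] G[of i "l x"] unfolding has_field_derivative_def by simp
      show "tame 1 k (\<lambda>x. G (Suc i) (l x) * l v)" for v
        by (rule tame_smooth_mult[OF Suc smooth_on_const])
    qed
  }
qed

text \<open>
  A function that is smooth and homogeneous of degree \<open>- d\<close> off the origin grows at most like
  \<open>\<bar>x\<bar>\<^bsup>- d\<^esup>\<close>, which is weaker than any negative power of a weight vanishing at \<open>0\<close> to infinite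
  order; its derivatives are homogeneous of degree \<open>- d - 1\<close>. Hence the singularity at the origin
  is invisible in terms of orders.
\<close>

lemma homogeneous_tame:
  assumes zero: "0 \<in> V \<Longrightarrow> S 0 = 0"
    and "Ck_on (- {0}) k Q" and "\<And>x c. x \<noteq> 0 \<Longrightarrow> 0 < c \<Longrightarrow> c ^ d * Q (c *\<^sub>R x) = Q x"
  shows "tame 0 k Q"
  using assms(2,3)
proof (induction k arbitrary: Q d)
  have pb: "power_bound 0 Q"
    if Q: "continuous_on (- {0}) Q" and hom: "\<And>x c. x \<noteq> 0 \<Longrightarrow> 0 < c \<Longrightarrow> c ^ d * Q (c *\<^sub>R x) = Q x"
    for Q d
    unfolding power_bound_def
  proof (intro allI impI ballI)
    fix p :: real and x0 assume p: "p < 0" and x0: "x0 \<in> V"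
    show "\<exists>C. \<forall>\<^sub>F x in nhds x0. x \<in> pos \<longrightarrow> \<bar>Q x\<bar> \<le> C * S x powr p"
    proof (cases "x0 = 0")
      case False
      have "isCont Q x0" using Q False by (simp add: continuous_on_eq_continuous_at open_Compl)
      then have "((\<lambda>x. \<bar>Q x\<bar>) \<longlongrightarrow> \<bar>Q x0\<bar>) (nhds x0)"
        by (intro tendsto_rabs) (metis isCont_def tendsto_at_iff_tendsto_nhds)
      then have "\<forall>\<^sub>F x in nhds x0. \<bar>Q x\<bar> < \<bar>Q x0\<bar> + 1" by (rule order_tendstoD) simp
      then have "\<forall>\<^sub>F x in nhds x0. x \<in> pos \<longrightarrow> \<bar>Q x\<bar> \<le> (\<bar>Q x0\<bar> + 1) * S x powr p"
      proof eventually_elim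
        case (elim x)
        show ?case
        proof
          assume "x \<in> pos"
          from one_le_powr[OF this, of p] have "(\<bar>Q x0\<bar> + 1) * 1 \<le> (\<bar>Q x0\<bar> + 1) * S x powr p"
            using p by (intro mult_left_mono) auto
          then show "\<bar>Q x\<bar> \<le> (\<bar>Q x0\<bar> + 1) * S x powr p" using elim by simp
        qed
      qed
      then show ?thesis by blast
    next
      case True
      have "compact (Q ` sphere 0 1)"
        using Q by (intro compact_continuous_image continuous_on_subset[OF Q]) auto
      then obtain B where B: "\<And>u. norm u = 1 \<Longrightarrow> \<bar>Q u\<bar> \<le> B"
        using compact_imp_bounded bounded_iff by (metis imageI mem_sphere_0 real_norm_def)
      \<comment> \<open>The denominator is \<open>d + 1\<close> rather than \<open>d\<close> so that \<open>d = 0\<close> needs no separate treatment.\<close>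
      define q where "q = - p / real (Suc d)"
      have q: "q > 0" unfolding q_def using p by (simp add: divide_neg_pos)
      obtain C where C: "\<And>x. x \<in> V \<Longrightarrow> S x powr q \<le> C * norm x"
        using S_flat[OF x0 _ q] zero x0 True by auto
      have "\<bar>Q x\<bar> \<le> \<bar>B\<bar> * \<bar>C\<bar> ^ d * S x powr p" if x: "x \<in> pos" for x
      proof -
        have S: "0 < S x" "S x \<le> 1" "x \<in> V" using x S_range unfolding pos_def by auto
        have "x \<noteq> 0" using zero S by auto
        define t where "t = S x powr q"
        have t: "0 < t" "t \<le> 1"
          unfolding t_def using S q powr_mono'[of 0 q "S x"] by auto
        have "\<bar>Q x\<bar> * norm x ^ d = \<bar>Q (inverse (norm x) *\<^sub>R x)\<bar>"
          using hom[OF \<open>x \<noteq> 0\<close>, of "inverse (norm x)"] \<open>x \<noteq> 0\<close>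
          by (auto simp: abs_mult power_inverse field_simps)
        also have "\<dots> \<le> B" using \<open>x \<noteq> 0\<close> by (intro B) simp
        finally have 1: "\<bar>Q x\<bar> * norm x ^ d \<le> \<bar>B\<bar>" by simp
        have "t \<le> \<bar>C\<bar> * norm x"
          unfolding t_def using C[OF S(3)] by (meson abs_ge_self mult_right_mono norm_ge_zero order_trans)
        then have "t ^ d \<le> (\<bar>C\<bar> * norm x) ^ d" using t by (intro power_mono) auto
        then have "\<bar>Q x\<bar> * t ^ d \<le> \<bar>Q x\<bar> * (\<bar>C\<bar> ^ d * norm x ^ d)"
          by (intro mult_left_mono) (auto simp: power_mult_distrib)
        also have "\<dots> = \<bar>C\<bar> ^ d * (\<bar>Q x\<bar> * norm x ^ d)" by simp
        also have "\<dots> \<le> \<bar>C\<bar> ^ d * \<bar>B\<bar>" by (intro mult_left_mono 1) auto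
        finally have 2: "\<bar>Q x\<bar> * t ^ d \<le> \<bar>B\<bar> * \<bar>C\<bar> ^ d" by (simp add: mult_ac)
        have "S x powr (- p) = t ^ Suc d"
          unfolding t_def q_def using S powr_realpow[of "S x powr (- p / real (Suc d))" "Suc d"]
          by (simp add: powr_powr)
        also have "\<dots> \<le> t ^ d" using t by (simp add: mult_left_le_one_le)
        finally have "\<bar>Q x\<bar> * S x powr (- p) \<le> \<bar>B\<bar> * \<bar>C\<bar> ^ d"
          using 2 by (meson abs_ge_zero mult_left_mono order_trans)
        then show ?thesis using S by (simp add: powr_minus field_simps)
      qed
      then show ?thesis by (intro exI[of _ "\<bar>B\<bar> * \<bar>C\<bar> ^ d"]) auto
    qed
  qed
  {
    case 0
    then show ?case using pb[of Q d] by simp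
  next
    case (Suc k)
    show ?case
    proof (rule derivs_satisfy_SucI[of pos "power_bound 0" Q "\<lambda>x. frechet_derivative Q (at x)",
          OF open_pos depends_on_power_bound])
      show "power_bound 0 Q" using Suc.prems by (intro pb[of Q d]) auto
      have nz: "x \<noteq> 0" if "x \<in> pos" for x using that zero unfolding pos_def by auto
      show "(Q has_derivative frechet_derivative Q (at x)) (at x)" if "x \<in> pos" for x
        using derivs_satisfy_SucD(1)[OF Suc.prems(1)] nz[OF that] by simp
      show "tame 0 k (\<lambda>x. frechet_derivative Q (at x) v)" for v
      proof (rule Suc.IH[OF derivs_satisfy_SucD(2)[OF Suc.prems(1)]])
        fix x :: 'a and c :: real assume x: "x \<noteq> 0" and c: "0 < c"
        have Q: "(Q has_derivative frechet_derivative Q (at (c *\<^sub>R x))) (at (c *\<^sub>R x))"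
          using derivs_satisfy_SucD(1)[OF Suc.prems(1), of "c *\<^sub>R x"] x c by simp
        have "((\<lambda>y. c *\<^sub>R y) has_derivative (\<lambda>v. c *\<^sub>R v)) (at x)"
          by (rule has_derivative_scaleR_right[OF has_derivative_ident])
        from has_derivative_compose[OF this Q]
        have "((\<lambda>y. Q (c *\<^sub>R y)) has_derivative
            (\<lambda>v. frechet_derivative Q (at (c *\<^sub>R x)) (c *\<^sub>R v))) (at x)" .
        then have "((\<lambda>y. c ^ d * Q (c *\<^sub>R y)) has_derivative
            (\<lambda>v. c ^ d * frechet_derivative Q (at (c *\<^sub>R x)) (c *\<^sub>R v))) (at x)"
          by (rule has_derivative_mult_right)
        then have "(Q has_derivative
            (\<lambda>v. c ^ d * frechet_derivative Q (at (c *\<^sub>R x)) (c *\<^sub>R v))) (at x)"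
        proof (rule has_derivative_cong_open[rotated 3])
          show "c ^ d * Q (c *\<^sub>R y) = Q y" if "y \<in> - {0}" for y
            using Suc.prems(2)[of y c] that c by simp
        qed (use x in auto)
        from fun_cong[OF frechet_derivative_eq[OF this], of v]
        have "frechet_derivative Q (at x) v = c ^ d * frechet_derivative Q (at (c *\<^sub>R x)) (c *\<^sub>R v)" .
        also have "frechet_derivative Q (at (c *\<^sub>R x)) (c *\<^sub>R v) =
            c * frechet_derivative Q (at (c *\<^sub>R x)) v"
          using linear_scale[OF has_derivative_linear[OF Q], of c v] by simp
        finally show "c ^ Suc d * frechet_derivative Q (at (c *\<^sub>R x)) v = frechet_derivative Q (at x) v"
          by (simp add: mult_ac)
      qed
    qed
  }
qed

definition extend :: "('a \<Rightarrow> real) \<Rightarrow> 'a \<Rightarrow> real" where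
  "extend f x = (if 0 < S x then f x else 0)"

text \<open>
  At a zero \<open>x\<^sub>0\<close> of \<open>S\<close> the extended function is \<open>O(\<bar>x - x\<^sub>0\<bar>\<^sup>2)\<close> because \<open>S\<close> vanishes there to
  infinite order and \<open>f\<close> is bounded by a positive power of \<open>S\<close>.
\<close>

lemma extend_has_derivative:
  assumes f: "power_bound s f" "0 < s" and F: "\<And>x. x \<in> pos \<Longrightarrow> (f has_derivative F x) (at x)"
    and x0: "x0 \<in> V"
  shows "(extend f has_derivative (\<lambda>v. extend (\<lambda>x. F x v) x0)) (at x0)"
proof (cases "0 < S x0")
  case True
  then have "x0 \<in> pos" unfolding pos_def using x0 by simp
  then have "(extend f has_derivative F x0) (at x0)"
    by (intro has_derivative_cong_open[OF open_pos _ _ F]) (auto simp: extend_def pos_def)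
  then show ?thesis using True unfolding extend_def by simp
next
  case False
  then have S0: "S x0 = 0" using S_range(1)[OF x0] by simp
  obtain C where "\<forall>\<^sub>F x in nhds x0. x \<in> pos \<longrightarrow> \<bar>f x\<bar> \<le> C * S x powr (s/2)"
    using f(1)[unfolded power_bound_def, rule_format, of "s/2" x0] f(2) x0 by auto
  moreover have "\<forall>\<^sub>F x in nhds x0. x \<in> V" using x0 V eventually_nhds by blast
  ultimately have "\<forall>\<^sub>F x in nhds x0. x \<in> V \<and> (x \<in> pos \<longrightarrow> \<bar>f x\<bar> \<le> C * S x powr (s/2))"
    by eventually_elim auto
  then obtain e where e: "0 < e" "\<And>x. dist x x0 < e \<Longrightarrow> x \<in> V"
      "\<And>x. dist x x0 < e \<Longrightarrow> x \<in> pos \<Longrightarrow> \<bar>f x\<bar> \<le> C * S x powr (s/2)"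
    unfolding eventually_nhds_metric by blast
  obtain B where B: "\<And>x. x \<in> V \<Longrightarrow> S x powr (s/4) \<le> B * norm (x - x0)"
    using S_flat[OF x0 S0, of "s/4"] f(2) by auto
  have bound: "\<bar>extend f y\<bar> \<le> \<bar>C\<bar> * B\<^sup>2 * (norm (y - x0))\<^sup>2" if "dist y x0 < e" for y
  proof (cases "0 < S y")
    case True
    then have y: "y \<in> pos" "y \<in> V" using e(2)[OF that] unfolding pos_def by auto
    have "\<bar>f y\<bar> \<le> \<bar>C\<bar> * S y powr (s/2)"
      using e(3)[OF that y(1)] by (meson abs_ge_self mult_right_mono order_trans powr_ge_zero)
    also have "S y powr (s/2) = (S y powr (s/4))\<^sup>2"
      by (simp add: power2_eq_square powr_add[symmetric])
    also have "\<bar>C\<bar> * (S y powr (s/4))\<^sup>2 \<le> \<bar>C\<bar> * (B * norm (y - x0))\<^sup>2"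
      using B[OF y(2)] by (intro mult_left_mono power_mono) auto
    finally show ?thesis using True by (simp add: extend_def power_mult_distrib mult_ac)
  qed (simp add: extend_def)
  have "(extend f has_derivative (\<lambda>v. 0)) (at x0 within UNIV)"
  proof (rule has_derivativeI_sandwich[OF e(1)])
    show "bounded_linear (\<lambda>v::'a. 0::real)" by simp
    show "((\<lambda>y. \<bar>C\<bar> * B\<^sup>2 * norm (y - x0)) \<longlongrightarrow> 0) (at x0 within UNIV)"
      by (auto intro!: tendsto_eq_intros)
    show "norm (extend f y - extend f x0 - 0) / norm (y - x0) \<le> \<bar>C\<bar> * B\<^sup>2 * norm (y - x0)"
      if "y \<in> UNIV" "y \<noteq> x0" "dist y x0 < e" for y
      using bound[OF that(3)] that(2) S0 by (simp add: extend_def divide_le_eq power2_eq_square mult_ac)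
  qed
  then show ?thesis using S0 unfolding extend_def by simp
qed

text \<open>
  Extension by zero commutes with differentiation, so the previous lemma can be iterated.
  Continuity is obtained from differentiability, which costs one derivative.
\<close>

lemma extend_Ck_on:
  assumes "tame s (Suc k) f" "0 < s" shows "Ck_on V k (extend f)"
  using assms(1)
proof (induction k arbitrary: f)
  have der: "(extend f has_derivative (\<lambda>v. extend (\<lambda>x. frechet_derivative f (at x) v) x)) (at x)"
    if f: "tame s (Suc k) f" and "x \<in> V" for x k f
    using extend_has_derivative[OF derivs_satisfy_base[OF f] assms(2) derivs_satisfy_SucD(1)[OF f]]
      that by blast
  {
    case 0
    then show ?case
      using der[OF 0] has_derivative_continuous continuous_at_imp_continuous_on
      by (metis derivs_satisfy.simps(1))
  next
    case (Suc k)
    show ?case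
      by (rule Ck_on_SucI[OF V der[OF Suc.prems] Suc.IH[OF derivs_satisfy_SucD(2)[OF Suc.prems]]])
  }
qed

end

section \<open>Periodization\<close>

lemma wrap_eqI:
  assumes "- pi \<le> x - 2 * pi * of_int n" "x - 2 * pi * of_int n < pi"
  shows "wrap x = x - 2 * pi * of_int n"
proof -
  have "\<lfloor>(x + pi) / (2 * pi)\<rfloor> = n"
    using assms by (intro floor_unique) (auto simp: field_simps)
  then show ?thesis unfolding wrap_def by simp
qed

lemma wrap_bounds: "- pi \<le> wrap x" "wrap x < pi"
proof -
  have "of_int \<lfloor>(x + pi) / (2 * pi)\<rfloor> * (2 * pi) \<le> x + pi"
    by (rule floor_divide_lower) simp
  then show "- pi \<le> wrap x" unfolding wrap_def by (simp add: algebra_simps)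
  have "x + pi < (of_int \<lfloor>(x + pi) / (2 * pi)\<rfloor> + 1) * (2 * pi)"
    by (rule floor_divide_upper) simp
  then show "wrap x < pi" unfolding wrap_def by (simp add: algebra_simps)
qed

lemma wrap_id: "\<bar>x\<bar> < pi \<Longrightarrow> wrap x = x"
  using wrap_eqI[of x 0] by auto

lemma wrap_wrap: "wrap (wrap x) = wrap x"
  using wrap_eqI[of "wrap x" 0] wrap_bounds[of x] by auto

lemma wrap_shift: "wrap (x + 2 * pi * of_int k) = wrap x"
proof -
  define n where "n = \<lfloor>(x + pi) / (2 * pi)\<rfloor>"
  have w: "wrap x = x - 2 * pi * of_int n" unfolding wrap_def n_def by simp
  have eq: "x + 2 * pi * of_int k - 2 * pi * of_int (n + k) = wrap x"
    unfolding w by (simp add: algebra_simps)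
  show ?thesis using wrap_eqI[of "x + 2 * pi * of_int k" "n + k", unfolded eq] wrap_bounds[of x] by blast
qed

lemma wrap2_nth [simp]: "wrap2 \<xi> $ i = wrap (\<xi> $ i)"
  unfolding wrap2_def by simp

lemma wrap2_wrap2 [simp]: "wrap2 (wrap2 \<xi>) = wrap2 \<xi>"
  by (simp add: vec_eq_iff wrap_wrap)

lemma wrap2_shift:
  assumes "k \<in> Z2" shows "wrap2 (\<xi> + (2 * pi) *\<^sub>R k) = wrap2 \<xi>"
proof -
  have "wrap (\<xi> $ i + 2 * pi * k $ i) = wrap (\<xi> $ i)" for i
  proof -
    obtain m where "k $ i = of_int m" using assms unfolding Z2_def by (auto elim: Ints_cases)
    then show ?thesis using wrap_shift[of "\<xi> $ i" m] by simp
  qed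
  then show ?thesis by (simp add: vec_eq_iff)
qed

lemma periodic2_wrap2: "periodic2 (\<lambda>\<xi>. f (wrap2 \<xi>))"
  unfolding periodic2_def by (simp add: wrap2_shift)

lemma smooth_on_translate:
  assumes "smooth_on UNIV f" shows "smooth_on UNIV (\<lambda>x. f (x - c))"
proof -
  have "Ck_on UNIV k (\<lambda>x. f (x - c))" if "Ck_on UNIV k f" for k f
    using that
  proof (induction k arbitrary: f)
    case 0
    have "continuous_on UNIV (\<lambda>x. x - c)" by (intro continuous_intros)
    with 0 show ?case using continuous_on_compose2[of UNIV f UNIV "\<lambda>x. x - c"] by simp
  next
    case (Suc k)
    show ?case
    proof (rule Ck_on_SucI)
      have sh: "((\<lambda>x. x - c) has_derivative (\<lambda>v. v)) (at x)" for x
        by (auto intro!: derivative_eq_intros)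
      show "((\<lambda>x. f (x - c)) has_derivative frechet_derivative f (at (x - c))) (at x)" for x
        using has_derivative_compose[OF sh derivs_satisfy_SucD(1)[OF Suc.prems UNIV_I]] .
      show "Ck_on UNIV k (\<lambda>x. frechet_derivative f (at (x - c)) v)" for v
        by (rule Suc.IH[OF derivs_satisfy_SucD(2)[OF Suc.prems]])
    qed simp
  qed
  then show ?thesis using assms unfolding smooth_on_def by blast
qed

text \<open>
  If the representative of \<open>x\<close> differs from the translate that is continuous at \<open>x\<^sub>0\<close>, then both
  lie near the ends \<open>\<plusminus>\<pi>\<close>, outside \<open>[-r, r]\<close>.
\<close>

lemma wrap_near:
  assumes r: "0 \<le> r" "r < pi" and n: "- pi \<le> x0 - 2 * pi * of_int n" "x0 - 2 * pi * of_int n < pi"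
    and near: "\<bar>x - x0\<bar> < pi - r" and ne: "wrap x \<noteq> x - 2 * pi * of_int n"
  shows "r < \<bar>wrap x\<bar>" "r < \<bar>x - 2 * pi * of_int n\<bar>"
proof -
  have "r < \<bar>wrap x\<bar> \<and> r < \<bar>x - 2 * pi * of_int n\<bar>"
  proof (cases "pi \<le> x - 2 * pi * of_int n")
    case True
    have "wrap x = x - 2 * pi * of_int (n + 1)"
      using True near n r by (intro wrap_eqI) (auto simp: algebra_simps)
    then show ?thesis using True near n r by (auto simp: algebra_simps)
  next
    case False
    have lt: "x - 2 * pi * of_int n < - pi"
      using wrap_eqI[of x n] ne False by force
    have "wrap x = x - 2 * pi * of_int (n - 1)"
      using lt near n r by (intro wrap_eqI) (auto simp: algebra_simps)
    then show ?thesis using lt near n r by (auto simp: algebra_simps)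
  qed
  then show "r < \<bar>wrap x\<bar>" "r < \<bar>x - 2 * pi * of_int n\<bar>" by auto
qed

text \<open>
  Near every point the periodization is a translate of \<open>F\<close>: where the representative jumps from
  \<open>\<pi>\<close> to \<open>-\<pi>\<close>, both \<open>F\<close> and its jumped copy vanish.
\<close>

lemma torus_smooth_periodization:
  fixes F :: "real^2 \<Rightarrow> real"
  assumes F: "smooth_on UNIV F" and r: "0 \<le> r" "r < pi"
    and supp: "\<And>\<xi> i. r < \<bar>\<xi> $ i\<bar> \<Longrightarrow> F \<xi> = 0"
  shows "torus_smooth (\<lambda>\<xi>. F (wrap2 \<xi>))"
proof -
  have "smooth_on UNIV (\<lambda>\<xi>. F (wrap2 \<xi>))"
  proof (rule smooth_on_local)
    fix x0 :: "real^2"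
    define n where "n = (\<lambda>i. \<lfloor>(x0 $ i + pi) / (2 * pi)\<rfloor>)"
    define c :: "real^2" where "c = (\<chi> i. 2 * pi * of_int (n i))"
    have n: "- pi \<le> x0 $ i - 2 * pi * of_int (n i)" "x0 $ i - 2 * pi * of_int (n i) < pi" for i
      using wrap_bounds[of "x0 $ i"] unfolding wrap_def n_def by auto
    have eq: "F (x - c) = F (wrap2 x)" if x: "x \<in> ball x0 (pi - r)" for x
    proof (cases "wrap2 x = x - c")
      case True
      then show ?thesis by simp
    next
      case False
      then obtain i where i: "wrap (x $ i) \<noteq> x $ i - 2 * pi * of_int (n i)"
        unfolding c_def by (auto simp: vec_eq_iff)
      have "\<bar>x $ i - x0 $ i\<bar> \<le> norm (x - x0)"
        using component_le_norm_cart[of "x - x0" i] by simp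
      then have "\<bar>x $ i - x0 $ i\<bar> < pi - r"
        using x by (simp add: dist_norm norm_minus_commute)
      from wrap_near[OF r n this i] show ?thesis
        using supp[of "wrap2 x" i] supp[of "x - c" i] unfolding c_def by simp
    qed
    have "smooth_on (ball x0 (pi - r)) (\<lambda>\<xi>. F (wrap2 \<xi>))"
    proof (rule smooth_on_cong[OF open_ball])
      show "smooth_on (ball x0 (pi - r)) (\<lambda>x. F (x - c))"
        by (rule smooth_on_subset[OF smooth_on_translate[OF F]]) simp
    qed (rule eq)
    then show "\<exists>V. open V \<and> x0 \<in> V \<and> smooth_on V (\<lambda>\<xi>. F (wrap2 \<xi>))"
      using r by (intro exI[of _ "ball x0 (pi - r)"]) auto
  qed simp
  then show ?thesis unfolding torus_smooth_def Csmooth_eq by (simp add: periodic2_wrap2)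
qed

section \<open>Transition functions\<close>

lemma derivatives_zero_on_open:
  fixes G :: "nat \<Rightarrow> real \<Rightarrow> real"
  assumes G: "\<And>i x. (G i has_real_derivative G (Suc i) x) (at x)"
    and "open U" "\<And>x. x \<in> U \<Longrightarrow> G 0 x = 0" "x \<in> U"
  shows "G i x = 0"
  using assms(4)
proof (induction i arbitrary: x)
  case 0
  then show ?case using assms(3) by simp
next
  case (Suc i)
  have "(G i has_real_derivative 0) (at x)"
    by (rule has_field_derivative_transform_within_open[of "\<lambda>_. 0" 0 x U])
      (use assms(2) Suc in auto)
  then show ?case using G[of i x] DERIV_unique by blast
qed

text \<open>
  All derivatives vanish at \<open>a\<close>, so the mean value theorem gains one power of \<open>s\<close> at a time.
\<close>

lemma flat_power_bound:
  fixes G :: "nat \<Rightarrow> real \<Rightarrow> real"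
  assumes G: "\<And>i x. (G i has_real_derivative G (Suc i) x) (at x)"
    and zero: "\<And>x. x \<le> a \<Longrightarrow> G 0 x = 0"
  shows "\<exists>C. \<forall>s\<in>{0..1}. \<bar>G i (a + s)\<bar> \<le> C * s ^ m"
proof (induction m arbitrary: i)
  case 0
  have cont: "continuous_on {a..a + 1} (G i)"
    using G DERIV_isCont continuous_at_imp_continuous_on by blast
  obtain B where B: "\<forall>y\<in>{a..a + 1}. \<bar>G i y\<bar> \<le> B"
    using compact_imp_bounded[OF compact_continuous_image[OF cont]] unfolding bounded_iff by auto
  then have "\<bar>G i (a + s)\<bar> \<le> B * s ^ 0" if "s \<in> {0..1}" for s using that B by auto
  then show ?case by blast
next
  case (Suc m)
  from Suc[of "Suc i"] obtain C where C: "\<And>s. s \<in> {0..1} \<Longrightarrow> \<bar>G (Suc i) (a + s)\<bar> \<le> C * s ^ m"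
    by blast
  have a0: "G i a = 0"
  proof (rule continuous_constant_on_closure[of "{..<a}" "G i" 0 a])
    show "continuous_on (closure {..<a}) (G i)"
      using G DERIV_isCont continuous_at_imp_continuous_on by blast
    show "G i x = 0" if "x \<in> {..<a}" for x
      using derivatives_zero_on_open[of G "{..<a}", OF G _ _ that] zero by simp
  qed (simp add: closure_lessThan)
  have "\<bar>G i (a + s)\<bar> \<le> \<bar>C\<bar> * s ^ Suc m" if s: "s \<in> {0..1}" for s
  proof (cases "s = 0")
    case True
    then show ?thesis using a0 by simp
  next
    case False
    then obtain z where z: "a < z" "z < a + s" "G i (a + s) - G i a = s * G (Suc i) z"
      using MVT2[of a "a + s" "G i" "G (Suc i)"] G s by auto
    have "\<bar>G (Suc i) z\<bar> \<le> C * (z - a) ^ m" using C[of "z - a"] z s by auto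
    also have "\<dots> \<le> \<bar>C\<bar> * (z - a) ^ m" using z by (intro mult_right_mono) auto
    also have "\<dots> \<le> \<bar>C\<bar> * s ^ m" using z by (intro mult_left_mono power_mono) auto
    finally have "s * \<bar>G (Suc i) z\<bar> \<le> s * (\<bar>C\<bar> * s ^ m)" using s by (intro mult_left_mono) auto
    then show ?thesis using z(3) a0 s by (simp add: abs_mult mult_ac)
  qed
  then show ?case by blast
qed

lemma compact_support_derivs_bounded:
  fixes G :: "nat \<Rightarrow> real \<Rightarrow> real"
  assumes G: "\<And>i x. (G i has_real_derivative G (Suc i) x) (at x)"
    and zero: "\<And>x. r < \<bar>x\<bar> \<Longrightarrow> G 0 x = 0"
  shows "\<exists>M. \<forall>x. \<bar>G i x\<bar> \<le> M"
proof -
  have cont: "continuous_on {-r..r} (G i)"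
    using G DERIV_isCont continuous_at_imp_continuous_on by blast
  obtain B where B: "\<forall>y\<in>{-r..r}. \<bar>G i y\<bar> \<le> B"
    using compact_imp_bounded[OF compact_continuous_image[OF cont]] unfolding bounded_iff by auto
  have "open {x. r < \<bar>x\<bar>}" by (intro open_Collect_less continuous_intros)
  from derivatives_zero_on_open[of G, OF G this] zero
  have Z: "G i x = 0" if "r < \<bar>x\<bar>" for x using that by simp
  have "\<bar>G i x\<bar> \<le> \<bar>B\<bar>" for x
  proof (cases "r < \<bar>x\<bar>")
    case False
    then have "- r \<le> x \<and> x \<le> r" by linarith
    then have "\<bar>G i x\<bar> \<le> B" using B by simp
    then show ?thesis by simp
  qed (simp add: Z)
  then show ?thesis by blast
qed

locale monotone_transition =
  fixes \<nu> :: "real \<Rightarrow> real"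
  assumes trans: "transition_fn \<nu>" and mono: "mono \<nu>"
begin

lemma nu_smooth: "smooth_on UNIV \<nu>"
  and nu_0: "x \<le> -1 \<Longrightarrow> \<nu> x = 0"
  and nu_1: "1 \<le> x \<Longrightarrow> \<nu> x = 1"
  and nu_sq: "(\<nu> x)\<^sup>2 + (\<nu> (- x))\<^sup>2 = 1"
  using trans unfolding transition_fn_def Csmooth_eq by auto

lemma nu_mono: "x \<le> y \<Longrightarrow> \<nu> x \<le> \<nu> y"
  using mono by (rule monoD)

lemma nu_nonneg: "0 \<le> \<nu> x"
  using nu_mono[of "min x (-1)" x] nu_0[of "min x (-1)"] by simp

lemma nu_le_1: "\<nu> x \<le> 1"
  using nu_mono[of x "max x 1"] nu_1[of "max x 1"] by simp

text \<open>
  By monotonicity, \<open>\<nu> x \<ge> \<nu> (- x)\<close> carries at least half of \<open>\<nu>\<^sup>2(x) + \<nu>\<^sup>2(- x) = 1\<close>. This yields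
  lower bounds although \<open>\<nu>\<close> may vanish well inside \<open>(-1, 0)\<close>.
\<close>

lemma nu_sq_half: "0 \<le> x \<Longrightarrow> 1/2 \<le> (\<nu> x)\<^sup>2"
  using nu_sq[of x] power_mono[OF nu_mono[of "- x" x] nu_nonneg, of 2] by simp

lemma nu_flat:
  assumes q: "0 < q" shows "\<exists>C\<ge>0. \<forall>s\<ge>0. \<nu> (- 1 + s) powr q \<le> C * s"
proof -
  obtain m :: nat where m: "1 < real m * q" using reals_Archimedean3[OF q] by blast
  obtain C where C: "\<forall>s\<in>{0..1}. \<bar>\<nu> (- 1 + s)\<bar> \<le> C * s ^ m"
    using flat_power_bound[of "\<lambda>i. (deriv ^^ i) \<nu>" "- 1" 0 m, OF smooth_derivative_sequence[OF nu_smooth]]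
      nu_0 by auto
  have "\<nu> (- 1 + s) powr q \<le> (\<bar>C\<bar> powr q + 1) * s" if s: "0 \<le> s" for s
  proof (cases "s \<le> 1")
    case True
    have "\<nu> (- 1 + s) \<le> C * s ^ m" using C[rule_format, of s] s True by auto
    also have "\<dots> \<le> \<bar>C\<bar> * s ^ m" using s by (intro mult_right_mono) auto
    finally have "\<nu> (- 1 + s) powr q \<le> (\<bar>C\<bar> * s ^ m) powr q"
      using nu_nonneg q by (intro powr_mono2) auto
    also have "\<dots> = \<bar>C\<bar> powr q * (s ^ m) powr q" using s by (simp add: powr_mult)
    also have "(s ^ m) powr q \<le> s"
    proof (cases "s = 0")
      case True
      have "m \<noteq> 0" using m by (intro notI) simp
      then show ?thesis using True by simp
    next
      case False
      then have "(s ^ m) powr q = s powr (real m * q)"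
        using s by (simp add: powr_realpow[symmetric] powr_powr)
      also have "\<dots> \<le> s powr 1" using m s \<open>s \<le> 1\<close> by (intro powr_mono') auto
      finally show ?thesis using s by simp
    qed
    finally have "\<nu> (- 1 + s) powr q \<le> \<bar>C\<bar> powr q * s" by (simp add: mult_left_mono)
    then show ?thesis using s by (simp add: algebra_simps)
  next
    case False
    have "\<nu> (- 1 + s) powr q \<le> 1 powr q"
      using nu_nonneg nu_le_1 q by (intro powr_mono2) auto
    also have "\<dots> \<le> 1 * s" using False by simp
    also have "\<dots> \<le> (\<bar>C\<bar> powr q + 1) * s" using s by (intro mult_right_mono) auto
    finally show ?thesis .
  qed
  then show ?thesis by (intro exI[of _ "\<bar>C\<bar> powr q + 1"]) auto
qed

text \<open>
  The modulus is harmless: since \<open>\<nu> = 1\<close> on \<open>[1, \<infinity>)\<close> and \<open>c \<ge> 1\<close>, the function is the product of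
  \<open>\<nu> (c - d x)\<close> and \<open>\<nu> (c + d x)\<close>, one of which is \<open>1\<close> at each point.
\<close>

lemma even_cutoff_smooth:
  assumes "1 \<le> c" "0 \<le> d" shows "smooth_on UNIV (\<lambda>x. \<nu> (c - d * \<bar>x\<bar>))"
proof -
  have "\<nu> (c - d * x) * \<nu> (c + d * x) = \<nu> (c - d * \<bar>x\<bar>)" for x
  proof (cases "0 \<le> x")
    case True
    then have "1 \<le> c + d * x" using assms by (simp add: add_increasing2)
    then show ?thesis using nu_1 True by simp
  next
    case False
    then have "1 \<le> c - d * x" using assms mult_nonneg_nonpos[of d x] by simp
    then show ?thesis using nu_1 False by simp
  qed
  moreover have "smooth_on UNIV (\<lambda>x. \<nu> (c + e * x))" for e
    by (rule smooth_on_compose[OF open_UNIV open_UNIV UNIV_I nu_smooth])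
      (intro smooth_on_add smooth_on_const smooth_on_linear bounded_linear_mult_right open_UNIV)
  from smooth_on_mult[OF open_UNIV this[of "- d"] this[of d]]
  have "smooth_on UNIV (\<lambda>x. \<nu> (c - d * x) * \<nu> (c + d * x))" by simp
  ultimately show ?thesis by simp
qed

end

section \<open>Angular windows\<close>

locale angular_windows = monotone_transition +
  fixes \<epsilon> :: real
  assumes \<epsilon>: "0 < \<epsilon>" "\<epsilon> \<le> 1/2"
begin

lemma gamma_smooth: "smooth_on UNIV (gamma_fn \<nu> \<epsilon>)"
proof -
  have "(\<lambda>x. \<nu> (1 / (2 * \<epsilon>) - 1 / \<epsilon> * \<bar>x\<bar>)) = gamma_fn \<nu> \<epsilon>"
    unfolding gamma_fn_def using \<epsilon> by (intro ext arg_cong[of _ _ \<nu>]) (simp add: field_simps)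
  then show ?thesis using even_cutoff_smooth[of "1 / (2 * \<epsilon>)" "1 / \<epsilon>"] \<epsilon> by (simp add: field_simps)
qed

lemma gamma_zero: "1 \<le> \<bar>x\<bar> \<Longrightarrow> gamma_fn \<nu> \<epsilon> x = 0"
  unfolding gamma_fn_def using \<epsilon> by (intro nu_0) (simp add: field_simps)

lemma gamma_half: "\<bar>x\<bar> \<le> 1/2 \<Longrightarrow> 1/2 \<le> (gamma_fn \<nu> \<epsilon> x)\<^sup>2"
  unfolding gamma_fn_def using \<epsilon> by (intro nu_sq_half) simp

text \<open>
  Near the line where the denominator vanishes, the quotient is large and the window is already
  \<open>0\<close>, in accordance with the convention for zero denominators.
\<close>

lemma gamma_quot_smooth:
  fixes i i' :: 2
  assumes c: "0 < c"
  shows "smooth_on {\<xi>::real^2. \<xi> $ i \<noteq> 0 \<or> \<xi> $ i' \<noteq> 0} (\<lambda>\<xi>. gamma_quot \<nu> \<epsilon> c (\<xi> $ i) (\<xi> $ i') m)"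
proof -
  let ?A = "{\<xi>::real^2. \<xi> $ i' \<noteq> 0}" and ?B = "{\<xi>::real^2. (\<bar>of_int m\<bar> + 1) * \<bar>\<xi> $ i'\<bar> < c * \<bar>\<xi> $ i\<bar>}"
  have A: "open ?A" by (intro open_Collect_neq continuous_intros)
  have B: "open ?B" by (intro open_Collect_less continuous_intros)
  have coord: "smooth_on U (\<lambda>\<xi>::real^2. \<xi> $ k)" if "open U" for U k
    using smooth_on_linear[OF that bounded_linear_vec_nth] .
  have sA: "smooth_on ?A (\<lambda>\<xi>. gamma_quot \<nu> \<epsilon> c (\<xi> $ i) (\<xi> $ i') m)"
  proof (rule smooth_on_cong[OF A])
    show "smooth_on ?A (\<lambda>\<xi>. gamma_fn \<nu> \<epsilon> (c * \<xi> $ i * inverse (\<xi> $ i') + of_int m))"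
    proof (rule smooth_on_compose[OF open_UNIV A UNIV_I gamma_smooth])
      have "smooth_on ?A (\<lambda>\<xi>. inverse (\<xi> $ i'))"
        by (rule smooth_on_compose[OF _ A _ smooth_on_inverse coord[OF A]]) auto
      then show "smooth_on ?A (\<lambda>\<xi>. c * \<xi> $ i * inverse (\<xi> $ i') + of_int m)"
        by (intro smooth_on_add smooth_on_mult smooth_on_const coord A)
    qed
  qed (simp add: gamma_quot_def divide_inverse)
  have sB: "smooth_on ?B (\<lambda>\<xi>. gamma_quot \<nu> \<epsilon> c (\<xi> $ i) (\<xi> $ i') m)"
  proof (rule smooth_on_cong[OF B smooth_on_const[of _ 0]])
    fix \<xi> :: "real^2" assume \<xi>: "\<xi> \<in> ?B"
    show "0 = gamma_quot \<nu> \<epsilon> c (\<xi> $ i) (\<xi> $ i') m"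
    proof (cases "\<xi> $ i' = 0")
      case False
      have "\<bar>of_int m\<bar> + 1 < c * \<bar>\<xi> $ i\<bar> / \<bar>\<xi> $ i'\<bar>" using \<xi> False by (simp add: pos_less_divide_eq)
      also have "\<dots> = \<bar>c * \<xi> $ i / \<xi> $ i'\<bar>" using c by (simp add: abs_mult)
      finally have "1 \<le> \<bar>c * \<xi> $ i / \<xi> $ i' + of_int m\<bar>" by linarith
      then show ?thesis using False by (simp add: gamma_quot_def gamma_zero)
    qed (simp add: gamma_quot_def)
  qed
  have "{\<xi>::real^2. \<xi> $ i \<noteq> 0 \<or> \<xi> $ i' \<noteq> 0} \<subseteq> ?A \<union> ?B"
    using c by (auto simp: not_less)
  then show ?thesis using smooth_on_subset[OF smooth_on_union[OF A B sA sB]] by blast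
qed

lemma ell_nat: "ell \<epsilon> (real n) = int n"
  unfolding ell_def using \<epsilon> by (intro floor_unique) auto

text \<open>
  On the cone \<open>\<bar>x\<bar> \<le> \<bar>y\<bar>\<close> the slope \<open>n x / y\<close> lies in \<open>[-n, n]\<close>, so the nearest integer has an
  admissible index.
\<close>

lemma gamma_quot_covers:
  assumes y: "y \<noteq> 0" "\<bar>x\<bar> \<le> \<bar>y\<bar>" and n: "0 < n"
  shows "\<exists>m\<in>{- int n..int n}. 1/2 \<le> (gamma_quot \<nu> \<epsilon> (real n) x y m)\<^sup>2"
proof -
  define z where "z = real n * x / y"
  have z: "\<bar>z\<bar> \<le> real n"
  proof -
    have "\<bar>z\<bar> = real n * (\<bar>x\<bar> / \<bar>y\<bar>)" unfolding z_def by (simp add: abs_mult)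
    also have "\<dots> \<le> real n * 1" using y by (intro mult_left_mono) (auto simp: divide_le_eq)
    finally show ?thesis by simp
  qed
  have r: "\<bar>z - of_int (round z)\<bar> \<le> 1/2" using of_int_round_abs_le[of z] by (simp add: abs_minus_commute)
  then have "\<bar>real_of_int (round z)\<bar> < real n + 1" using z by linarith
  then have "- round z \<in> {- int n..int n}" by auto
  moreover have "1/2 \<le> (gamma_quot \<nu> \<epsilon> (real n) x y (- round z))\<^sup>2"
    using r y gamma_half[of "z - of_int (round z)"] unfolding gamma_quot_def z_def by simp
  ultimately show ?thesis by blast
qed

lemma Gamma_pos:
  assumes n: "lam > 0" and \<xi>: "\<xi> \<noteq> 0" shows "0 < Gamma_fn \<nu> lam \<epsilon> j \<xi>"
proof -
  define n where "n = lam ^ j"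
  have n0: "0 < n" unfolding n_def using n by simp
  have n_real: "real lam ^ j = real n" unfolding n_def by simp
  let ?f = "\<lambda>m. \<bar>gamma_quot \<nu> \<epsilon> (real n) (\<xi> $ 2) (\<xi> $ 1) m\<bar>\<^sup>2 + \<bar>gamma_quot \<nu> \<epsilon> (real n) (\<xi> $ 1) (\<xi> $ 2) m\<bar>\<^sup>2"
  have nz: "\<xi> $ 1 \<noteq> 0 \<or> \<xi> $ 2 \<noteq> 0" using \<xi> by (simp add: vec_eq_iff forall_2)
  have "\<exists>m\<in>{- int n..int n}. 1/2 \<le> ?f m"
  proof (cases "\<bar>\<xi> $ 2\<bar> \<le> \<bar>\<xi> $ 1\<bar>")
    case True
    then obtain m where "m\<in>{- int n..int n}" "1/2 \<le> (gamma_quot \<nu> \<epsilon> (real n) (\<xi> $ 2) (\<xi> $ 1) m)\<^sup>2"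
      using gamma_quot_covers[of "\<xi> $ 1" "\<xi> $ 2" n] nz n0 by fastforce
    then show ?thesis by (intro bexI[of _ m]) (auto intro: add_increasing2)
  next
    case False
    then obtain m where "m\<in>{- int n..int n}" "1/2 \<le> (gamma_quot \<nu> \<epsilon> (real n) (\<xi> $ 1) (\<xi> $ 2) m)\<^sup>2"
      using gamma_quot_covers[of "\<xi> $ 2" "\<xi> $ 1" n] nz n0 by fastforce
    then show ?thesis by (intro bexI[of _ m]) (auto intro: add_increasing)
  qed
  then obtain m where m: "m \<in> {- int n..int n}" "1/2 \<le> ?f m" by blast
  have "?f m \<le> sum ?f {- int n..int n}" using m(1) by (intro member_le_sum) auto
  then show ?thesis using m(2) unfolding Gamma_fn_def n_real ell_nat by linarith
qed

lemma coordinates_nonzero: "- {0} = {\<xi>::real^2. \<xi> $ 2 \<noteq> 0 \<or> \<xi> $ 1 \<noteq> 0}"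
    "- {0} = {\<xi>::real^2. \<xi> $ 1 \<noteq> 0 \<or> \<xi> $ 2 \<noteq> 0}"
  by (auto simp: vec_eq_iff forall_2)

definition angular :: "nat \<Rightarrow> nat \<Rightarrow> int \<Rightarrow> real^2 \<Rightarrow> real" where
  "angular lam j l \<xi> =
     gamma_quot \<nu> \<epsilon> (real lam ^ j) (\<xi> $ 2) (\<xi> $ 1) l / sqrt (Gamma_fn \<nu> lam \<epsilon> j \<xi>)"

lemma angular_smooth:
  assumes lam: "lam > 0" shows "smooth_on (- {0}) (angular lam j l)"
proof -
  have U: "open (- {0::real^2})" by auto
  have c: "0 < real lam ^ j" using lam by simp
  have g1: "smooth_on (- {0}) (\<lambda>\<xi>::real^2. gamma_quot \<nu> \<epsilon> (real lam ^ j) (\<xi> $ 2) (\<xi> $ 1) m)" for m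
    unfolding coordinates_nonzero(1) by (rule gamma_quot_smooth[OF c])
  have g2: "smooth_on (- {0}) (\<lambda>\<xi>::real^2. gamma_quot \<nu> \<epsilon> (real lam ^ j) (\<xi> $ 1) (\<xi> $ 2) m)" for m
    unfolding coordinates_nonzero(2) by (rule gamma_quot_smooth[OF c])
  have "smooth_on (- {0}) (Gamma_fn \<nu> lam \<epsilon> j)"
    unfolding Gamma_fn_def[abs_def] power2_abs
    by (intro smooth_on_sum smooth_on_add smooth_on_power2 U g1 g2)
  then have "smooth_on (- {0}) (\<lambda>\<xi>. Gamma_fn \<nu> lam \<epsilon> j \<xi> powr (- (1/2)))"
    by (intro smooth_on_compose[OF _ U _ smooth_on_powr]) (auto simp: Gamma_pos lam)
  from smooth_on_mult[OF U g1[of l] this]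
  show ?thesis
  proof (rule smooth_on_cong[OF U])
    fix \<xi> :: "real^2" assume "\<xi> \<in> - {0}"
    then have "0 \<le> Gamma_fn \<nu> lam \<epsilon> j \<xi>" using Gamma_pos[of lam \<xi> j] lam by simp
    then have "Gamma_fn \<nu> lam \<epsilon> j \<xi> powr (- (1/2)) = inverse (sqrt (Gamma_fn \<nu> lam \<epsilon> j \<xi>))"
      by (simp only: powr_minus powr_half_sqrt)
    then show "gamma_quot \<nu> \<epsilon> (real lam ^ j) (\<xi> $ 2) (\<xi> $ 1) l * Gamma_fn \<nu> lam \<epsilon> j \<xi> powr (- (1/2)) =
        angular lam j l \<xi>"
      unfolding angular_def divide_inverse by (simp only:)
  qed
qed

lemma gamma_quot_scale: "c \<noteq> 0 \<Longrightarrow> gamma_quot \<nu> \<epsilon> k (c * x) (c * y) m = gamma_quot \<nu> \<epsilon> k x y m"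
  unfolding gamma_quot_def by (simp add: mult.left_commute)

lemma angular_scale: "c \<noteq> 0 \<Longrightarrow> angular lam j l (c *\<^sub>R \<xi>) = angular lam j l \<xi>"
  unfolding angular_def Gamma_fn_def by (simp add: gamma_quot_scale)

end

section \<open>The radial profile\<close>

locale shearlet_masks = angular_windows +
  fixes lam :: nat and t \<rho> :: real
  assumes lam: "1 < lam" and t: "0 < t" "t \<le> 1" and \<rho>: "0 < \<rho>" "\<rho> < 1"
begin

definition N :: real where "N = (real lam)\<^sup>2"

abbreviation \<alpha> :: "real \<Rightarrow> real" where "\<alpha> \<equiv> alpha_fn \<nu> lam t \<rho>"

abbreviation "c\<alpha> \<equiv> (2 - t) / t"
abbreviation "d\<alpha> \<equiv> 2 * N / (t * \<rho> * pi)"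

lemma N: "4 \<le> N"
proof -
  have "2\<^sup>2 \<le> (real lam)\<^sup>2" using lam by (intro power_mono) auto
  then show ?thesis unfolding N_def by simp
qed

lemma c\<alpha>: "1 \<le> c\<alpha>" and d\<alpha>: "0 < d\<alpha>"
  using t \<rho> N by (auto simp: field_simps)

lemma alpha_eq: "\<alpha> x = \<nu> (c\<alpha> - d\<alpha> * \<bar>x\<bar>)"
  unfolding alpha_fn_def N_def using t \<rho> by (intro arg_cong[of _ _ \<nu>]) (simp add: field_simps)

lemma alpha_smooth: "smooth_on UNIV \<alpha>"
proof -
  have "\<alpha> = (\<lambda>x. \<nu> (c\<alpha> - d\<alpha> * \<bar>x\<bar>))" using alpha_eq by (rule ext)
  then show ?thesis using even_cutoff_smooth[of c\<alpha> d\<alpha>] c\<alpha> d\<alpha> by simp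
qed

lemma alpha_range: "0 \<le> \<alpha> x" "\<alpha> x \<le> 1"
  unfolding alpha_eq using nu_nonneg nu_le_1 by auto

lemma alpha_decreasing: "\<bar>x\<bar> \<le> \<bar>y\<bar> \<Longrightarrow> \<alpha> y \<le> \<alpha> x"
  unfolding alpha_eq using d\<alpha> by (intro nu_mono diff_left_mono mult_left_mono) auto

lemma alpha_dilate_le: "\<alpha> (N * x) \<le> \<alpha> x"
  using N by (intro alpha_decreasing) (simp add: abs_mult mult_le_cancel_right1)

lemma alpha_0: "\<alpha> 0 = 1"
  unfolding alpha_eq using c\<alpha> nu_1 by simp

lemma alpha_support: "\<alpha> x \<noteq> 0 \<Longrightarrow> \<bar>x\<bar> < \<rho> * pi / N"
proof (rule ccontr)
  assume a: "\<alpha> x \<noteq> 0" and "\<not> \<bar>x\<bar> < \<rho> * pi / N"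
  then have "d\<alpha> * (\<rho> * pi / N) \<le> d\<alpha> * \<bar>x\<bar>" using d\<alpha> by (intro mult_left_mono) auto
  moreover have "d\<alpha> * (\<rho> * pi / N) = 2 / t" using \<rho> N by (simp add: field_simps)
  moreover have "c\<alpha> - 2 / t = - 1" using t by (simp add: field_simps)
  ultimately have "c\<alpha> - d\<alpha> * \<bar>x\<bar> \<le> - 1" by linarith
  then show False using a nu_0 unfolding alpha_eq by simp
qed

lemma alpha_dilate_support: "\<alpha> (N * x) \<noteq> 0 \<Longrightarrow> \<bar>x\<bar> < \<rho> * pi / N\<^sup>2"
  using alpha_support[of "N * x"] N by (simp add: abs_mult field_simps power2_eq_square)

text \<open>
  The argument of \<open>\<nu>\<close> is nonnegative up to half of the support radius. As \<open>N \<ge> 4\<close>, this range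
  contains the support of \<open>\<alpha> (N x)\<close>, so the quotient defining \<open>\<mu>\<close> is smooth.
\<close>

lemma alpha_half: "\<bar>x\<bar> \<le> \<rho> * pi / (2 * N) \<Longrightarrow> 1/2 \<le> (\<alpha> x)\<^sup>2"
proof -
  assume "\<bar>x\<bar> \<le> \<rho> * pi / (2 * N)"
  then have "d\<alpha> * \<bar>x\<bar> \<le> d\<alpha> * (\<rho> * pi / (2 * N))" using d\<alpha> by (intro mult_left_mono) auto
  moreover have "d\<alpha> * (\<rho> * pi / (2 * N)) = 1 / t" using \<rho> N by (simp add: field_simps)
  moreover have "1 / t \<le> c\<alpha>" using t by (simp add: field_simps)
  ultimately have "0 \<le> c\<alpha> - d\<alpha> * \<bar>x\<bar>" by linarith
  then show ?thesis unfolding alpha_eq by (rule nu_sq_half)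
qed

lemma radii: "\<rho> * pi / N\<^sup>2 < \<rho> * pi / (2 * N)" "\<rho> * pi / N < pi / 4"
    "0 < \<rho> * pi / N\<^sup>2"
    "\<rho> * pi / N\<^sup>2 < \<rho> * pi / N"
proof -
  have sq: "2 * N < N\<^sup>2" "N < N\<^sup>2" using N by (auto simp: power2_eq_square)
  show "\<rho> * pi / N\<^sup>2 < \<rho> * pi / (2 * N)" "\<rho> * pi / N\<^sup>2 < \<rho> * pi / N"
    using sq \<rho> N by (auto intro!: divide_strict_left_mono)
  have "\<rho> * pi / N \<le> \<rho> * pi / 4" using N \<rho> by (intro divide_left_mono) auto
  also have "\<dots> < pi / 4" using \<rho> by simp
  finally show "\<rho> * pi / N < pi / 4" .
  show "0 < \<rho> * pi / N\<^sup>2" using \<rho> N by auto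
qed

text \<open>
  The increment is at most \<open>1 - \<alpha>(N x)\<^sup>2 = \<nu>(\<dots>)\<^sup>2\<close>, with an argument of \<open>\<nu>\<close> that exceeds \<open>-1\<close> by
  at most a multiple of \<open>\<bar>x\<bar>\<close>; hence it inherits the flatness of \<open>\<nu>\<close> at \<open>-1\<close>.
\<close>

lemma dilation_increment:
  obtains D :: "nat \<Rightarrow> real \<Rightarrow> real"
  where "\<And>x. D 0 x = (\<alpha> x)\<^sup>2 - (\<alpha> (N * x))\<^sup>2"
    and "\<And>i x. (D i has_real_derivative D (Suc i) x) (at x)"
    and "\<And>i p. 0 < p \<Longrightarrow> p < 1 \<Longrightarrow> \<exists>C. \<forall>x. \<bar>D i x\<bar> \<le> C * D 0 x powr p"
    and "\<And>q. 0 < q \<Longrightarrow> \<exists>C. \<forall>x x0. D 0 x0 = 0 \<longrightarrow> D 0 x powr q \<le> C * \<bar>x - x0\<bar>"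
proof -
  define K where "K = (\<lambda>i. (deriv ^^ i) (\<lambda>x. (\<alpha> x)\<^sup>2))"
  have K0: "K 0 x = (\<alpha> x)\<^sup>2" for x unfolding K_def by simp
  have K_deriv: "(K i has_real_derivative K (Suc i) x) (at x)" for i x
    unfolding K_def by (rule smooth_derivative_sequence[OF smooth_on_power2[OF open_UNIV alpha_smooth]])
  have "\<exists>M. \<forall>x. \<bar>K i x\<bar> \<le> M" for i
  proof (rule compact_support_derivs_bounded[of K, OF K_deriv])
    show "K 0 x = 0" if "\<rho> * pi / N < \<bar>x\<bar>" for x
      using that alpha_support[of x] unfolding K0 by force
  qed
  then obtain M where M: "\<And>i x. \<bar>K i x\<bar> \<le> M i" by metis
  interpret dilation_profile K N M
  proof
    show "0 \<le> K 0 x" "K 0 x \<le> 1" for x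
      unfolding K0 using alpha_range[of x] by (auto intro: power_le_one)
    show "K 0 y \<le> K 0 x" if "\<bar>x\<bar> \<le> \<bar>y\<bar>" for x y
      unfolding K0 using alpha_decreasing[OF that] alpha_range by (intro power_mono) auto
    show "1 < N" using N by simp
    show "\<exists>C. \<forall>x. (K 0 x - K 0 (N * x)) powr q \<le> C * \<bar>x\<bar>" if q: "0 < q" for q
    proof -
      obtain C where C: "0 \<le> C" "\<And>s. 0 \<le> s \<Longrightarrow> \<nu> (- 1 + s) powr (2 * q) \<le> C * s"
        using nu_flat[of "2 * q"] q by auto
      have "(K 0 x - K 0 (N * x)) powr q \<le> (C * (d\<alpha> * N)) * \<bar>x\<bar>" for x
      proof -
        define s where "s = d\<alpha> * \<bar>N * x\<bar>"
        have s: "0 \<le> s" "s = d\<alpha> * N * \<bar>x\<bar>"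
          unfolding s_def using mult_nonneg_nonneg[OF less_imp_le[OF d\<alpha>] abs_ge_zero[of "N * x"]] N
          by (simp_all add: abs_mult)
        have "K 0 x - K 0 (N * x) \<le> 1 - (\<nu> (c\<alpha> - s))\<^sup>2"
          unfolding K0 alpha_eq[of "N * x"] s_def using alpha_range[of x] power_le_one[of "\<alpha> x" 2] by simp
        also have "\<dots> = (\<nu> (- (c\<alpha> - s)))\<^sup>2" using nu_sq[of "c\<alpha> - s"] by linarith
        also have "\<dots> \<le> (\<nu> (- 1 + s))\<^sup>2"
          using c\<alpha> nu_nonneg by (intro power_mono nu_mono) auto
        finally have le: "K 0 x - K 0 (N * x) \<le> (\<nu> (- 1 + s))\<^sup>2" .
        have "0 \<le> K 0 x - K 0 (N * x)"
          unfolding K0 using alpha_dilate_le alpha_range by (simp add: power_mono)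
        then have "(K 0 x - K 0 (N * x)) powr q \<le> ((\<nu> (- 1 + s))\<^sup>2) powr q"
          using le q by (intro powr_mono2) auto
        also have "\<dots> = \<nu> (- 1 + s) powr (2 * q)"
          using nu_nonneg[of "- 1 + s"]
          by (simp add: powr_add[symmetric] powr_mult power2_eq_square flip: mult_2)
        also have "\<dots> \<le> C * s" by (rule C(2)[OF s(1)])
        finally show ?thesis unfolding s(2) by (simp add: mult.assoc)
      qed
      then show ?thesis by blast
    qed
  qed (fact K_deriv M)+
  show ?thesis
  proof (rule that[of D])
    show "D 0 x = (\<alpha> x)\<^sup>2 - (\<alpha> (N * x))\<^sup>2" for x unfolding D_def K0 by simp
  qed (fact D_deriv D_derivs_bound D_flat_at_zeros)+
qed

section \<open>Smoothness of the masks\<close>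

text \<open>
  The non-periodic version of \<open>\<mu>\<close>. Outside the support of \<open>\<alpha>\<close> the formula has value \<open>0 / 0 = 0\<close>,
  as it should.
\<close>

definition \<mu>0 :: "real \<Rightarrow> real" where "\<mu>0 x = \<alpha> (N * x) / \<alpha> x"

lemma mu_eq: "mu_fn \<nu> lam t \<rho> x = \<mu>0 (wrap x)"
  using alpha_support[of "wrap x"] unfolding mu_fn_def \<mu>0_def N_def Let_def by auto

lemma mu0_range: "0 \<le> \<mu>0 x" "\<mu>0 x \<le> 1"
  unfolding \<mu>0_def using alpha_range alpha_dilate_le[of x] by (auto simp: divide_le_eq_1 less_le)

lemma mu0_support: "\<mu>0 x \<noteq> 0 \<Longrightarrow> \<bar>x\<bar> < \<rho> * pi / N\<^sup>2"
  unfolding \<mu>0_def using alpha_dilate_support[of x] by auto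

lemma alpha_dilate_smooth: "smooth_on UNIV (\<lambda>x. \<alpha> (N * x))"
  by (rule smooth_on_compose[of UNIV UNIV "\<lambda>x. N * x" \<alpha>])
    (simp_all add: alpha_smooth smooth_on_linear bounded_linear_mult_right)

lemma alpha_inverse_smooth: "smooth_on {x. \<bar>x\<bar> < \<rho> * pi / (2 * N)} (\<lambda>x. inverse (\<alpha> x))"
proof (rule smooth_on_compose[OF _ _ _ smooth_on_inverse])
  show "\<alpha> x \<in> - {0}" if "x \<in> {x. \<bar>x\<bar> < \<rho> * pi / (2 * N)}" for x
    using alpha_half[of x] that by auto
  show "smooth_on {x. \<bar>x\<bar> < \<rho> * pi / (2 * N)} \<alpha>"
    by (rule smooth_on_subset[OF alpha_smooth]) simp
  show "open {x. \<bar>x\<bar> < \<rho> * pi / (2 * N)}" by (intro open_Collect_less continuous_intros)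
qed auto

lemma mu0_smooth: "smooth_on UNIV \<mu>0"
proof -
  let ?A = "{x. \<bar>x\<bar> < \<rho> * pi / (2 * N)}" and ?B = "{x. \<rho> * pi / N\<^sup>2 < \<bar>x\<bar>}"
  have A: "open ?A" and B: "open ?B" by (intro open_Collect_less continuous_intros)+
  have "smooth_on ?A (\<lambda>x. \<alpha> (N * x) * inverse (\<alpha> x))"
    by (intro smooth_on_mult A alpha_inverse_smooth smooth_on_subset[OF alpha_dilate_smooth]) simp
  then have sA: "smooth_on ?A \<mu>0"
    by (rule smooth_on_cong[OF A]) (simp only: \<mu>0_def divide_inverse)
  have sB: "smooth_on ?B \<mu>0"
    by (rule smooth_on_cong[OF B smooth_on_const[of _ 0]]) (use mu0_support in force)
  have "UNIV \<subseteq> ?A \<union> ?B" using radii(1) by auto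
  then show ?thesis using smooth_on_subset[OF smooth_on_union[OF A B sA sB]] by blast
qed

lemma smooth_on_coordinate:
  fixes k :: 2 and W :: "real set"
  assumes "open U" "open W" "smooth_on W f" "\<And>\<xi>. \<xi> \<in> U \<Longrightarrow> \<xi> $ k \<in> W"
  shows "smooth_on U (\<lambda>\<xi>::real^2. f (\<xi> $ k))"
  by (rule smooth_on_compose[of W U "\<lambda>\<xi>. \<xi> $ k" f])
    (simp_all add: assms smooth_on_linear bounded_linear_vec_nth)

definition a0 :: "real^2 \<Rightarrow> real" where "a0 \<xi> = \<mu>0 (\<xi> $ 1) * \<mu>0 (\<xi> $ 2)"

lemma a0_smooth: "smooth_on UNIV a0"
  unfolding a0_def[abs_def]
  by (intro smooth_on_mult open_UNIV smooth_on_coordinate[OF open_UNIV open_UNIV mu0_smooth] UNIV_I)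

lemma mask_a_eq: "mask_a \<nu> lam t \<rho> \<xi> = a0 (wrap2 \<xi>)"
  unfolding mask_a_def a0_def mu_eq by simp

lemma a0_range: "0 \<le> a0 \<xi>" "a0 \<xi> \<le> 1"
  unfolding a0_def using mu0_range by (auto intro: mult_le_one)

lemma a0_support: "a0 \<xi> \<noteq> 0 \<Longrightarrow> \<bar>\<xi> $ i\<bar> < \<rho> * pi / N\<^sup>2"
  using exhaust_2[of i] mu0_support unfolding a0_def by auto

lemma mask_a_torus_smooth: "torus_smooth (mask_a \<nu> lam t \<rho>)"
proof -
  have "torus_smooth (\<lambda>\<xi>. a0 (wrap2 \<xi>))"
  proof (rule torus_smooth_periodization[OF a0_smooth])
    show "0 \<le> \<rho> * pi / N\<^sup>2" "\<rho> * pi / N\<^sup>2 < pi" using radii(2,3,4) pi_gt_zero by linarith+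
    show "a0 \<xi> = 0" if "\<rho> * pi / N\<^sup>2 < \<bar>\<xi> $ i\<bar>" for \<xi> i using a0_support[of \<xi> i] that by linarith
  qed
  then show ?thesis by (simp add: mask_a_eq[abs_def])
qed

text \<open>
  Where \<open>a \<noteq> 0\<close> this is the radicand \<open>g - \<bar>a\<bar>\<^sup>2\<close>, for \<open>g = 1\<close> there. Its zeros may be complicated:
  besides the origin there are zeros wherever \<open>\<alpha>(N x) = \<alpha>(x) > 0\<close> in both coordinates, which can
  happen on plateaus of \<open>\<nu>\<close>.
\<close>

definition S :: "real^2 \<Rightarrow> real" where "S \<xi> = 1 - (a0 \<xi>)\<^sup>2"

text \<open>
  Here both \<open>\<alpha>(\<xi>\<^sub>1)\<close> and \<open>\<alpha>(\<xi>\<^sub>2)\<close> are bounded below; outside a smaller square the mask vanishes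
  and \<open>S = 1\<close>.
\<close>

definition core :: "(real^2) set" where
  "core = {\<xi>. \<bar>\<xi> $ 1\<bar> < \<rho> * pi / (2 * N) \<and> \<bar>\<xi> $ 2\<bar> < \<rho> * pi / (2 * N)}"

lemma open_core: "open core"
  unfolding core_def by (intro open_Collect_conj open_Collect_less continuous_intros)

lemma S_range: "0 \<le> S \<xi>" "S \<xi> \<le> 1"
  unfolding S_def using a0_range[of \<xi>] by (auto intro: power_le_one)

lemma S_0: "S 0 = 0"
  unfolding S_def a0_def \<mu>0_def by (simp add: alpha_0)

text \<open>
  \<open>S\<close> is at least \<open>1 - \<mu>(\<xi>\<^sub>i)\<^sup>2\<close> because \<open>\<mu> \<le> 1\<close> in the other coordinate, and \<open>\<alpha> \<le> 1\<close>. Thus bounds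
  in terms of the one-dimensional increments turn into bounds in terms of \<open>S\<close>.
\<close>

lemma S_lower_bound: "(\<alpha> (\<xi> $ i))\<^sup>2 - (\<alpha> (N * \<xi> $ i))\<^sup>2 \<le> S \<xi>"
proof (cases "\<alpha> (\<xi> $ i) = 0")
  case True
  then show ?thesis by (intro order_trans[OF _ S_range(1)]) simp
next
  case False
  then have pos: "0 < (\<alpha> (\<xi> $ i))\<^sup>2" "(\<alpha> (\<xi> $ i))\<^sup>2 \<le> 1"
    using alpha_range by (auto intro: power_le_one)
  have mu: "(\<mu>0 x)\<^sup>2 \<le> 1" for x using mu0_range by (auto intro: power_le_one)
  have "(\<alpha> (\<xi> $ i))\<^sup>2 - (\<alpha> (N * \<xi> $ i))\<^sup>2 = (\<alpha> (\<xi> $ i))\<^sup>2 * (1 - (\<mu>0 (\<xi> $ i))\<^sup>2)"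
    using False unfolding \<mu>0_def by (simp add: power_divide field_simps)
  also have "\<dots> \<le> 1 * (1 - (\<mu>0 (\<xi> $ i))\<^sup>2)" using pos mu by (intro mult_right_mono) auto
  also have "\<dots> \<le> S \<xi>"
    using exhaust_2[of i] mult_left_le_one_le[of "(\<mu>0 (\<xi> $ 1))\<^sup>2" "(\<mu>0 (\<xi> $ 2))\<^sup>2"]
      mult_left_le_one_le[of "(\<mu>0 (\<xi> $ 2))\<^sup>2" "(\<mu>0 (\<xi> $ 1))\<^sup>2"] mu
    unfolding S_def a0_def by (auto simp: power_mult_distrib mult.commute)
  finally show ?thesis .
qed

text \<open>
  Telescoping \<open>1 - \<mu>\<^sub>1\<^sup>2 \<mu>\<^sub>2\<^sup>2 = (1 - \<mu>\<^sub>1\<^sup>2) + \<mu>\<^sub>1\<^sup>2 (1 - \<mu>\<^sub>2\<^sup>2)\<close>, with denominators cleared so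
  that every factor other than the increments is smooth.
\<close>

lemma S_decomposition:
  assumes "\<xi> \<in> core"
  defines "D \<equiv> \<lambda>x. (\<alpha> x)\<^sup>2 - (\<alpha> (N * x))\<^sup>2"
  shows "S \<xi> = D (\<xi> $ 1) * (inverse (\<alpha> (\<xi> $ 1)))\<^sup>2 +
      D (\<xi> $ 2) * ((\<alpha> (N * \<xi> $ 1))\<^sup>2 * (inverse (\<alpha> (\<xi> $ 1)))\<^sup>2 * (inverse (\<alpha> (\<xi> $ 2)))\<^sup>2)"
proof -
  have "\<alpha> (\<xi> $ 1) \<noteq> 0" "\<alpha> (\<xi> $ 2) \<noteq> 0"
    using alpha_half[of "\<xi> $ 1"] alpha_half[of "\<xi> $ 2"] assms(1) unfolding core_def by auto
  then show ?thesis
    unfolding S_def a0_def \<mu>0_def D_def by (simp add: power_mult_distrib power_divide field_simps)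
qed

lemma S_upper_bound:
  assumes \<xi>: "\<xi> \<in> core"
  defines "D \<equiv> \<lambda>x. (\<alpha> x)\<^sup>2 - (\<alpha> (N * x))\<^sup>2"
  shows "S \<xi> \<le> 2 * D (\<xi> $ 1) + 2 * D (\<xi> $ 2)"
proof -
  have D: "0 \<le> D x" for x
    unfolding D_def using alpha_dilate_le alpha_range by (simp add: power_mono)
  have inv: "(inverse (\<alpha> (\<xi> $ i)))\<^sup>2 \<le> 2" for i
  proof -
    have "1/2 \<le> (\<alpha> (\<xi> $ i))\<^sup>2"
      using \<xi> exhaust_2[of i] unfolding core_def by (intro alpha_half) auto
    then have "inverse ((\<alpha> (\<xi> $ i))\<^sup>2) \<le> inverse (1/2)" by (intro le_imp_inverse_le) auto
    then show ?thesis by (simp add: power_inverse)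
  qed
  have "(\<alpha> (N * \<xi> $ 1))\<^sup>2 * (inverse (\<alpha> (\<xi> $ 1)))\<^sup>2 = (\<mu>0 (\<xi> $ 1))\<^sup>2"
    unfolding \<mu>0_def by (simp add: divide_inverse power_mult_distrib)
  also have "\<dots> \<le> 1" using mu0_range by (auto intro: power_le_one)
  finally have "(\<alpha> (N * \<xi> $ 1))\<^sup>2 * (inverse (\<alpha> (\<xi> $ 1)))\<^sup>2 * (inverse (\<alpha> (\<xi> $ 2)))\<^sup>2 \<le> 1 * 2"
    using inv by (intro mult_mono) auto
  then have "D (\<xi> $ 2) * ((\<alpha> (N * \<xi> $ 1))\<^sup>2 * (inverse (\<alpha> (\<xi> $ 1)))\<^sup>2 * (inverse (\<alpha> (\<xi> $ 2)))\<^sup>2) \<le> D (\<xi> $ 2) * 2"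
    using D by (intro mult_left_mono) auto
  moreover have "D (\<xi> $ 1) * (inverse (\<alpha> (\<xi> $ 1)))\<^sup>2 \<le> D (\<xi> $ 1) * 2"
    using D inv by (intro mult_left_mono) auto
  ultimately show ?thesis
    using S_decomposition[OF \<xi>] unfolding D_def by linarith
qed

lemma flat_weight_core: "flat_weight core S"
proof
  show "open core" by (rule open_core)
  have "smooth_on core (\<lambda>\<xi>. 1 - (a0 \<xi>)\<^sup>2)"
    by (intro smooth_on_diff smooth_on_power2 smooth_on_const open_core smooth_on_subset[OF a0_smooth]) simp
  then show "continuous_on core S"
    unfolding smooth_on_def S_def[abs_def] by (metis derivs_satisfy.simps(1))
  show "0 \<le> S \<xi>" "S \<xi> \<le> 1" for \<xi> using S_range by auto
  fix \<xi>0 q assume \<xi>0: "\<xi>0 \<in> core" and z: "S \<xi>0 = 0" and q: "(0::real) < q"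
  obtain D where D: "\<And>x. D (0::nat) x = (\<alpha> x)\<^sup>2 - (\<alpha> (N * x))\<^sup>2"
    and flat: "\<exists>C. \<forall>x x0. D 0 x0 = 0 \<longrightarrow> D 0 x powr q \<le> C * \<bar>x - x0\<bar>"
    using dilation_increment q by metis
  have D_nonneg: "0 \<le> D 0 x" for x
    unfolding D using alpha_dilate_le alpha_range by (simp add: power_mono)
  from flat obtain C where C: "\<And>x x0. D 0 x0 = 0 \<Longrightarrow> D 0 x powr q \<le> C * \<bar>x - x0\<bar>" by blast
  have Dz: "D 0 (\<xi>0 $ i) = 0" for i
    using S_lower_bound[of \<xi>0 i] z D_nonneg[of "\<xi>0 $ i"] unfolding D by linarith
  have bound: "D 0 (\<xi> $ i) powr q \<le> \<bar>C\<bar> * norm (\<xi> - \<xi>0)" for \<xi> i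
  proof -
    have "D 0 (\<xi> $ i) powr q \<le> C * \<bar>\<xi> $ i - \<xi>0 $ i\<bar>" using C[OF Dz] .
    also have "\<dots> \<le> \<bar>C\<bar> * norm (\<xi> - \<xi>0)"
      using component_le_norm_cart[of "\<xi> - \<xi>0" i] by (intro mult_mono) auto
    finally show ?thesis .
  qed
  have "S \<xi> powr q \<le> (4 powr q * \<bar>C\<bar>) * norm (\<xi> - \<xi>0)" if \<xi>: "\<xi> \<in> core" for \<xi>
  proof -
    obtain i :: 2 where i: "S \<xi> \<le> 4 * D 0 (\<xi> $ i)"
    proof (cases "D 0 (\<xi> $ 1) \<le> D 0 (\<xi> $ 2)")
      case True
      then have "S \<xi> \<le> 4 * D 0 (\<xi> $ 2)" using S_upper_bound[OF \<xi>, folded D] by linarith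
      then show ?thesis by (rule that)
    next
      case False
      then have "S \<xi> \<le> 4 * D 0 (\<xi> $ 1)" using S_upper_bound[OF \<xi>, folded D] by linarith
      then show ?thesis by (rule that)
    qed
    have "S \<xi> powr q \<le> (4 * D 0 (\<xi> $ i)) powr q" using i S_range q by (intro powr_mono2) auto
    also have "\<dots> = 4 powr q * D 0 (\<xi> $ i) powr q" using D_nonneg by (simp add: powr_mult)
    also have "\<dots> \<le> 4 powr q * (\<bar>C\<bar> * norm (\<xi> - \<xi>0))" using bound by (intro mult_left_mono) auto
    finally show ?thesis by simp
  qed
  then show "\<exists>C. \<forall>x\<in>core. S x powr q \<le> C * norm (x - \<xi>0)" by blast
qed

sublocale W: flat_weight core S
  by (rule flat_weight_core)

lemma S_tame: "W.tame 1 k S"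
proof -
  obtain D where D: "\<And>x. D (0::nat) x = (\<alpha> x)\<^sup>2 - (\<alpha> (N * x))\<^sup>2"
    and D_deriv: "\<And>i x. (D i has_real_derivative D (Suc i) x) (at x)"
    and D_bound: "\<And>i p. 0 < p \<Longrightarrow> p < 1 \<Longrightarrow> \<exists>C. \<forall>x. \<bar>D i x\<bar> \<le> C * D 0 x powr p"
    using dilation_increment by metis
  have D_tame: "W.tame 1 k (\<lambda>\<xi>. D 0 (\<xi> $ i))" for i
  proof (rule W.tame_linear_compose[of D "D 0" "\<lambda>\<xi>. \<xi> $ i", OF D_deriv D_bound])
    show "0 \<le> D 0 x" for x
      unfolding D using alpha_dilate_le alpha_range by (simp add: power_mono)
    show "D 0 (\<xi> $ i) \<le> S \<xi>" for \<xi> unfolding D by (rule S_lower_bound)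
  qed (simp_all add: bounded_linear_vec_nth)
  have inv: "smooth_on core (\<lambda>\<xi>. inverse (\<alpha> (\<xi> $ i)))" for i
  proof (rule smooth_on_coordinate[OF open_core _ alpha_inverse_smooth])
    show "open {x. \<bar>x\<bar> < \<rho> * pi / (2 * N)}" by (intro open_Collect_less continuous_intros)
    show "\<xi> $ i \<in> {x. \<bar>x\<bar> < \<rho> * pi / (2 * N)}" if "\<xi> \<in> core" for \<xi>
      using that exhaust_2[of i] unfolding core_def by auto
  qed
  have dil: "smooth_on core (\<lambda>\<xi>. \<alpha> (N * \<xi> $ i))" for i
    by (rule smooth_on_coordinate[OF open_core open_UNIV alpha_dilate_smooth UNIV_I])
  have "W.tame 1 k (\<lambda>\<xi>. D 0 (\<xi> $ 1) * (inverse (\<alpha> (\<xi> $ 1)))\<^sup>2 +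
      D 0 (\<xi> $ 2) * ((\<alpha> (N * \<xi> $ 1))\<^sup>2 * (inverse (\<alpha> (\<xi> $ 1)))\<^sup>2 * (inverse (\<alpha> (\<xi> $ 2)))\<^sup>2))"
    by (intro W.tame_add W.tame_smooth_mult D_tame smooth_on_mult smooth_on_power2 open_core inv dil)
  then show ?thesis
    by (rule W.tame_cong) (simp add: S_decomposition D W.pos_def)
qed

text \<open>
  The square root has order \<open>1/2\<close> and the angular factor order \<open>0\<close>, so their product extends
  smoothly by \<open>0\<close>. Treating the two factors together is essential at the origin, where the angular
  factor alone is singular.
\<close>

lemma sqrt_S_angular_smooth: "smooth_on UNIV (\<lambda>\<xi>. sqrt (S \<xi>) * angular lam j l \<xi>)"
proof -
  let ?W = "\<lambda>\<xi>. sqrt (S \<xi>) * angular lam j l \<xi>"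
  let ?B = "{\<xi>::real^2. \<rho> * pi / N\<^sup>2 < \<bar>\<xi> $ 1\<bar> \<or> \<rho> * pi / N\<^sup>2 < \<bar>\<xi> $ 2\<bar>}"
  have lam0: "lam > 0" using lam by simp
  have ang: "W.tame 0 k (angular lam j l)" for k
  proof (rule W.homogeneous_tame[where d = 0])
    show "Ck_on (- {0}) k (angular lam j l)" using angular_smooth[OF lam0] unfolding smooth_on_def by blast
  qed (simp_all add: S_0 angular_scale)
  have "smooth_on core (W.extend (\<lambda>\<xi>. S \<xi> powr (1/2) * angular lam j l \<xi>))"
    unfolding smooth_on_def
  proof
    fix k
    have "W.tame (1/2 + 0) (Suc k) (\<lambda>\<xi>. S \<xi> powr (1/2) * angular lam j l \<xi>)"
      by (rule W.tame_mult[OF W.tame_powr[OF S_tame] ang])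
    then show "Ck_on core k (W.extend (\<lambda>\<xi>. S \<xi> powr (1/2) * angular lam j l \<xi>))"
      by (rule W.extend_Ck_on) simp
  qed
  then have sA: "smooth_on core ?W"
  proof (rule smooth_on_cong[OF open_core])
    show "W.extend (\<lambda>\<xi>. S \<xi> powr (1/2) * angular lam j l \<xi>) \<xi> = ?W \<xi>" for \<xi>
      using S_range(1)[of \<xi>] unfolding W.extend_def by (simp add: powr_half_sqrt less_le)
  qed
  have B: "open ?B" by (intro open_Collect_disj open_Collect_less continuous_intros)
  have sB: "smooth_on ?B ?W"
  proof (rule smooth_on_cong[OF B])
    show "smooth_on ?B (angular lam j l)"
      using radii(3) by (intro smooth_on_subset[OF angular_smooth[OF lam0]]) auto
    show "angular lam j l \<xi> = ?W \<xi>" if "\<xi> \<in> ?B" for \<xi>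
    proof -
      have "a0 \<xi> = 0" using a0_support[of \<xi> 1] a0_support[of \<xi> 2] that by force
      then show ?thesis unfolding S_def by simp
    qed
  qed
  have "UNIV \<subseteq> core \<union> ?B" using radii(1) unfolding core_def by auto
  then show ?thesis using smooth_on_subset[OF smooth_on_union[OF open_core B sA sB]] by blast
qed

text \<open>
  A periodic cutoff. Inserting the cosine avoids any periodization: \<open>2 cos x \<ge> 1\<close> for \<open>\<bar>x\<bar> \<le> \<pi>/3\<close>
  and \<open>2 cos x \<le> -1\<close> for \<open>2\<pi>/3 \<le> \<bar>x\<bar> \<le> \<pi>\<close>.
\<close>

definition h :: "real \<Rightarrow> real" where "h x = \<nu> (2 * cos x)"

lemma h_smooth: "smooth_on UNIV h"
  unfolding h_def[abs_def]
  by (rule smooth_on_compose[of UNIV UNIV "\<lambda>x. 2 * cos x" \<nu>])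
    (simp_all add: nu_smooth smooth_on_mult smooth_on_const smooth_on_cos)

lemma h_1: "\<bar>x\<bar> \<le> pi / 3 \<Longrightarrow> h x = 1"
proof -
  assume "\<bar>x\<bar> \<le> pi / 3"
  then have "cos (pi / 3) \<le> cos \<bar>x\<bar>" by (intro cos_monotone_0_pi_le) auto
  then show ?thesis unfolding h_def by (intro nu_1) (simp add: cos_60)
qed

lemma h_0: "2 * pi / 3 < \<bar>x\<bar> \<Longrightarrow> \<bar>x\<bar> \<le> pi \<Longrightarrow> h x = 0"
proof -
  assume "2 * pi / 3 < \<bar>x\<bar>" "\<bar>x\<bar> \<le> pi"
  then have "cos \<bar>x\<bar> \<le> cos (2 * pi / 3)" by (intro cos_monotone_0_pi_le) auto
  then show ?thesis unfolding h_def by (intro nu_0) (simp add: cos_120)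
qed

lemma h_wrap: "h (wrap x) = h x"
proof -
  have "cos (x - 2 * pi * of_int m) = cos x" for m
    using cos.plus_of_int[of x "- m"] by (simp add: algebra_simps)
  then show ?thesis unfolding h_def wrap_def by simp
qed

text \<open>
  Near the edges of \<open>[-\<pi>, \<pi>]\<^sup>2\<close> the factor \<open>H\<close> has to vanish, because the angular factors do not
  match on opposite edges. Taking \<open>g\<close> to be a square makes its square root smooth.
\<close>

definition H :: "real^2 \<Rightarrow> real" where "H \<xi> = h (\<xi> $ 1) * h (\<xi> $ 2)"
definition g :: "real^2 \<Rightarrow> real" where "g \<xi> = (H \<xi>)\<^sup>2"

lemma H_smooth: "smooth_on UNIV H"
  unfolding H_def[abs_def]
  by (intro smooth_on_mult open_UNIV smooth_on_coordinate[OF open_UNIV open_UNIV h_smooth] UNIV_I)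

lemma H_wrap2: "H (wrap2 \<xi>) = H \<xi>"
  unfolding H_def by (simp add: h_wrap)

lemma H_1: "(\<And>i. \<bar>\<xi> $ i\<bar> \<le> pi / 3) \<Longrightarrow> H \<xi> = 1"
  unfolding H_def by (simp add: h_1)

lemma H_nonneg: "0 \<le> H \<xi>"
  unfolding H_def h_def using nu_nonneg by simp

lemma g_torus_smooth: "torus_smooth g"
proof -
  have "g = (\<lambda>\<xi>. g (wrap2 \<xi>))" unfolding g_def by (simp add: H_wrap2)
  then have "periodic2 g" using periodic2_wrap2[of g] by simp
  then show ?thesis
    unfolding torus_smooth_def Csmooth_eq g_def[abs_def]
    using smooth_on_power2[OF open_UNIV H_smooth] by simp
qed

lemma a0_nonzero_H: "a0 \<xi> \<noteq> 0 \<Longrightarrow> H \<xi> = 1"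
proof (rule H_1)
  fix i assume "a0 \<xi> \<noteq> 0"
  from a0_support[OF this, of i] show "\<bar>\<xi> $ i\<bar> \<le> pi / 3"
    using radii(2,4) pi_gt_zero by linarith
qed

text \<open>
  Wherever \<open>a \<noteq> 0\<close> the cutoff equals \<open>1\<close>, so \<open>\<bar>a\<bar>\<^sup>2\<close> may be multiplied by \<open>H\<^sup>2\<close>.
\<close>

lemma g_minus_a0: "g \<xi> - (a0 \<xi>)\<^sup>2 = (H \<xi>)\<^sup>2 * S \<xi>"
  using a0_nonzero_H[of \<xi>] unfolding g_def S_def by (cases "a0 \<xi> = 0") auto

lemma mask_b_eq: "mask_b \<nu> lam t \<rho> g \<xi> = H \<xi> * sqrt (S (wrap2 \<xi>))"
proof -
  have "mask_b \<nu> lam t \<rho> g \<xi> = sqrt (g (wrap2 \<xi>) - (a0 (wrap2 \<xi>))\<^sup>2)"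
    unfolding mask_b_def Let_def mask_a_eq by simp
  also have "\<dots> = H \<xi> * sqrt (S (wrap2 \<xi>))"
    unfolding g_minus_a0 using H_nonneg by (simp add: real_sqrt_mult H_wrap2)
  finally show ?thesis .
qed

lemma mask_bjl_eq:
  "mask_bjl \<nu> lam t \<rho> \<epsilon> g j l \<xi> =
    H (wrap2 \<xi>) * (sqrt (S (wrap2 \<xi>)) * angular lam j l (wrap2 \<xi>))"
  unfolding mask_bjl_def Let_def mask_b_eq angular_def by (simp add: S_0)

text \<open>
  The function \<open>F\<close> itself is not supported in the square, since \<open>H\<close> is periodic; it is cut down to
  the central box, at whose boundary \<open>H\<close> already vanishes.
\<close>

lemma mask_bjl_torus_smooth: "torus_smooth (mask_bjl \<nu> lam t \<rho> \<epsilon> g j l)"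
proof -
  define F where "F = (\<lambda>\<xi>. H \<xi> * (sqrt (S \<xi>) * angular lam j l \<xi>))"
  define Box where "Box = {\<xi>::real^2. \<forall>i. \<bar>\<xi> $ i\<bar> \<le> 2 * pi / 3}"
  define F' where "F' = (\<lambda>\<xi>. if \<xi> \<in> Box then F \<xi> else 0)"
  have F: "smooth_on UNIV F"
    unfolding F_def by (intro smooth_on_mult open_UNIV H_smooth sqrt_S_angular_smooth)
  have out: "F \<xi> = 0" if "\<xi> \<notin> Box" "\<And>i. \<bar>\<xi> $ i\<bar> \<le> pi" for \<xi>
  proof -
    have "\<exists>i. 2 * pi / 3 < \<bar>\<xi> $ i\<bar>" using that(1) unfolding Box_def by (simp add: not_le)
    then obtain i where "2 * pi / 3 < \<bar>\<xi> $ i\<bar>" ..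
    then have "h (\<xi> $ i) = 0" using h_0 that(2) by blast
    then show ?thesis using exhaust_2[of i] unfolding F_def H_def by auto
  qed
  have "smooth_on UNIV F'"
  proof -
    let ?A = "{\<xi>::real^2. \<bar>\<xi> $ 1\<bar> < pi \<and> \<bar>\<xi> $ 2\<bar> < pi}"
    let ?B = "{\<xi>::real^2. 2 * pi / 3 < \<bar>\<xi> $ 1\<bar> \<or> 2 * pi / 3 < \<bar>\<xi> $ 2\<bar>}"
    have A: "open ?A" by (intro open_Collect_conj open_Collect_less continuous_intros)
    have B: "open ?B" by (intro open_Collect_disj open_Collect_less continuous_intros)
    have sA: "smooth_on ?A F'"
    proof (rule smooth_on_cong[OF A smooth_on_subset[OF F]])
      show "F \<xi> = F' \<xi>" if "\<xi> \<in> ?A" for \<xi>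
      proof -
        have "\<bar>\<xi> $ i\<bar> \<le> pi" for i using that exhaust_2[of i] by auto
        then show ?thesis using out[of \<xi>] unfolding F'_def by simp
      qed
    qed simp
    have sB: "smooth_on ?B F'"
      by (rule smooth_on_cong[OF B smooth_on_const[of _ 0]]) (auto simp: F'_def Box_def forall_2)
    have "2 * pi / 3 < pi" by simp
    then have "(\<bar>\<xi> $ 1\<bar> < pi \<and> \<bar>\<xi> $ 2\<bar> < pi) \<or> 2 * pi / 3 < \<bar>\<xi> $ 1\<bar> \<or> 2 * pi / 3 < \<bar>\<xi> $ 2\<bar>"
      for \<xi> :: "real^2" by linarith
    then have "UNIV \<subseteq> ?A \<union> ?B" by blast
    then show ?thesis using smooth_on_subset[OF smooth_on_union[OF A B sA sB]] by blast
  qed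
  then have "torus_smooth (\<lambda>\<xi>. F' (wrap2 \<xi>))"
  proof (rule torus_smooth_periodization[of _ "2 * pi / 3"])
    show "F' \<xi> = 0" if "2 * pi / 3 < \<bar>\<xi> $ i\<bar>" for \<xi> i
    proof -
      have "\<xi> \<notin> Box" using that unfolding Box_def by (auto simp: not_le)
      then show ?thesis unfolding F'_def by simp
    qed
  qed auto
  moreover have "F' (wrap2 \<xi>) = mask_bjl \<nu> lam t \<rho> \<epsilon> g j l \<xi>" for \<xi>
  proof -
    have "\<bar>wrap2 \<xi> $ i\<bar> \<le> pi" for i using wrap_bounds[of "\<xi> $ i"] by simp
    then show ?thesis using out[of "wrap2 \<xi>"] unfolding F'_def mask_bjl_eq F_def by auto
  qed
  ultimately show ?thesis by simp
qed

section \<open>Refinement and perfect reconstruction\<close>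

lemma M_mat_mult: "M_mat lam *v \<xi> = N *\<^sub>R \<xi>"
  unfolding M_mat_def N_def
  by (simp add: vec_eq_iff forall_2 mat_def matrix_vector_mult_def sum_2)

lemma phi_support: "phi_fn \<nu> lam t \<rho> \<xi> \<noteq> 0 \<Longrightarrow> \<bar>\<xi> $ i\<bar> < \<rho> * pi / N"
  using exhaust_2[of i] alpha_support unfolding phi_fn_def by auto

lemma phi_support_wrap: "phi_fn \<nu> lam t \<rho> \<xi> \<noteq> 0 \<Longrightarrow> wrap2 \<xi> = \<xi>"
proof -
  assume a: "phi_fn \<nu> lam t \<rho> \<xi> \<noteq> 0"
  have "\<bar>\<xi> $ i\<bar> < pi" for i using phi_support[OF a, of i] radii(2) pi_gt_zero by linarith
  then show ?thesis by (simp add: vec_eq_iff wrap_id)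
qed

lemma phi_support_H: "phi_fn \<nu> lam t \<rho> \<xi> \<noteq> 0 \<Longrightarrow> H \<xi> = 1"
proof (rule H_1)
  fix i assume "phi_fn \<nu> lam t \<rho> \<xi> \<noteq> 0"
  from phi_support[OF this, of i] show "\<bar>\<xi> $ i\<bar> \<le> pi / 3"
    using radii(2) pi_gt_zero by linarith
qed

lemma phi_dilate: "phi_fn \<nu> lam t \<rho> (N *\<^sub>R \<xi>) = a0 \<xi> * phi_fn \<nu> lam t \<rho> \<xi>"
proof -
  have "\<alpha> (N * x) = \<mu>0 x * \<alpha> x" for x
    unfolding \<mu>0_def using alpha_dilate_le[of x] alpha_range(1)[of "N * x"] by (cases "\<alpha> x = 0") auto
  then show ?thesis unfolding phi_fn_def a0_def by simp
qed

lemma refinement_a: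
  "phi_fn \<nu> lam t \<rho> (M_mat lam *v \<xi>) = mask_a \<nu> lam t \<rho> \<xi> * phi_fn \<nu> lam t \<rho> \<xi>"
  unfolding M_mat_mult phi_dilate mask_a_eq
  using phi_support_wrap[of \<xi>] by (cases "phi_fn \<nu> lam t \<rho> \<xi> = 0") auto

lemma omega_dilate: "omega_fn \<nu> lam t \<rho> (N *\<^sub>R \<xi>) = sqrt (S \<xi>) * phi_fn \<nu> lam t \<rho> \<xi>"
proof -
  have phi0: "0 \<le> phi_fn \<nu> lam t \<rho> \<xi>" unfolding phi_fn_def using alpha_range by simp
  have "omega_fn \<nu> lam t \<rho> (N *\<^sub>R \<xi>) =
      sqrt ((phi_fn \<nu> lam t \<rho> \<xi>)\<^sup>2 - (phi_fn \<nu> lam t \<rho> (N *\<^sub>R \<xi>))\<^sup>2)"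
    unfolding omega_fn_def using N by (simp add: N_def[symmetric])
  also have "\<dots> = sqrt (S \<xi> * (phi_fn \<nu> lam t \<rho> \<xi>)\<^sup>2)"
    unfolding phi_dilate S_def by (simp add: power_mult_distrib algebra_simps)
  finally show ?thesis using phi0 by (simp add: real_sqrt_mult)
qed

lemma refinement_b:
  "psi_fn \<nu> lam t \<rho> \<epsilon> j l (M_mat lam *v \<xi>) =
    mask_bjl \<nu> lam t \<rho> \<epsilon> g j l \<xi> * phi_fn \<nu> lam t \<rho> \<xi>"
proof -
  have "psi_fn \<nu> lam t \<rho> \<epsilon> j l (N *\<^sub>R \<xi>) = sqrt (S \<xi>) * phi_fn \<nu> lam t \<rho> \<xi> * angular lam j l \<xi>"
  proof (cases "\<xi> = 0")
    case True
    then show ?thesis by (simp add: psi_fn_def S_0)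
  next
    case False
    then have "psi_fn \<nu> lam t \<rho> \<epsilon> j l (N *\<^sub>R \<xi>) =
        omega_fn \<nu> lam t \<rho> (N *\<^sub>R \<xi>) * angular lam j l (N *\<^sub>R \<xi>)"
      using N unfolding psi_fn_def angular_def by simp
    also have "angular lam j l (N *\<^sub>R \<xi>) = angular lam j l \<xi>" using N by (intro angular_scale) simp
    finally show ?thesis unfolding omega_dilate .
  qed
  also have "\<dots> = mask_bjl \<nu> lam t \<rho> \<epsilon> g j l \<xi> * phi_fn \<nu> lam t \<rho> \<xi>"
    unfolding mask_bjl_eq using phi_support_wrap[of \<xi>] phi_support_H[of \<xi>]
    by (cases "phi_fn \<nu> lam t \<rho> \<xi> = 0") auto
  finally show ?thesis unfolding M_mat_mult .
qed

lemma sigma_shift: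
  assumes "\<xi> \<in> sigma_set (phi_fn \<nu> lam t \<rho>)"
  obtains k where "k \<in> Z2" "phi_fn \<nu> lam t \<rho> (\<xi> + (2 * pi) *\<^sub>R k) \<noteq> 0"
proof (rule ccontr)
  note found = that
  assume none: "\<not> thesis"
  have "\<bar>phi_fn \<nu> lam t \<rho> (\<xi> + (2 * pi) *\<^sub>R k)\<bar>\<^sup>2 = 0" if "k \<in> Z2" for k
    using found[OF that] none by auto
  then have "(\<Sum>\<^sub>\<infinity>k\<in>Z2. \<bar>phi_fn \<nu> lam t \<rho> (\<xi> + (2 * pi) *\<^sub>R k)\<bar>\<^sup>2) = 0" by (rule infsum_0)
  then show False using assms unfolding sigma_set_def by simp
qed

lemma E_mat_mult: "(E_mat *v \<xi>) $ 1 = \<xi> $ 2" "(E_mat *v \<xi>) $ 2 = \<xi> $ 1"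
  unfolding E_mat_def by (simp_all add: matrix_vector_mult_def sum_2 vector_2)

text \<open>
  Exchanging the coordinates exchanges the horizontal and the vertical windows and leaves \<open>S\<close>, \<open>H\<close>
  and \<open>\<Gamma>\<close> unchanged. So the squares of the windows add up to \<open>\<Gamma>\<close>, and the sum over \<open>l\<close> is
  \<open>S = 1 - \<bar>a\<bar>\<^sup>2\<close>, as \<open>g = 1\<close> on \<open>\<sigma>\<^sub>\<phi>\<close>. At the lattice points, where all \<open>b\<^bsup>j,l\<^esup>\<close> are \<open>0\<close> by
  convention, the identity still holds because \<open>a = 1\<close>.
\<close>

lemma perfect_reconstruction:
  assumes \<sigma>: "\<xi> \<in> sigma_set (phi_fn \<nu> lam t \<rho>)"
  shows "\<bar>mask_a \<nu> lam t \<rho> \<xi>\<bar>\<^sup>2 +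
     (\<Sum>l = - ell \<epsilon> (real lam ^ j)..ell \<epsilon> (real lam ^ j).
        \<bar>mask_bjl \<nu> lam t \<rho> \<epsilon> g j l \<xi>\<bar>\<^sup>2 + \<bar>mask_bjl \<nu> lam t \<rho> \<epsilon> g j l (E_mat *v \<xi>)\<bar>\<^sup>2) = 1"
proof -
  obtain k where k: "k \<in> Z2" "phi_fn \<nu> lam t \<rho> (\<xi> + (2 * pi) *\<^sub>R k) \<noteq> 0"
    using sigma_shift[OF \<sigma>] .
  define \<eta> where "\<eta> = wrap2 \<xi>"
  define \<eta>' where "\<eta>' = E_mat *v \<eta>"
  let ?I = "{- ell \<epsilon> (real lam ^ j)..ell \<epsilon> (real lam ^ j)}"
  have "H \<eta> = H (\<xi> + (2 * pi) *\<^sub>R k)" unfolding \<eta>_def using H_wrap2 wrap2_shift[OF k(1)] by metis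
  then have H\<eta>: "H \<eta> = 1" using phi_support_H[OF k(2)] by simp
  have swap: "wrap2 (E_mat *v \<xi>) = \<eta>'"
    unfolding \<eta>'_def \<eta>_def by (simp add: vec_eq_iff forall_2 E_mat_mult)
  have sym: "H \<eta>' = 1" "S \<eta>' = S \<eta>" "Gamma_fn \<nu> lam \<epsilon> j \<eta>' = Gamma_fn \<nu> lam \<epsilon> j \<eta>"
    using H\<eta> unfolding \<eta>'_def H_def S_def a0_def Gamma_fn_def by (simp_all add: E_mat_mult mult.commute add.commute)
  have "(\<Sum>l\<in>?I. \<bar>mask_bjl \<nu> lam t \<rho> \<epsilon> g j l \<xi>\<bar>\<^sup>2 + \<bar>mask_bjl \<nu> lam t \<rho> \<epsilon> g j l (E_mat *v \<xi>)\<bar>\<^sup>2) =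
      S \<eta>"
  proof (cases "\<eta> = 0")
    case True
    then show ?thesis
      using sym(2) S_0 unfolding mask_bjl_eq swap \<eta>_def[symmetric] by simp
  next
    case False
    let ?\<Gamma> = "Gamma_fn \<nu> lam \<epsilon> j \<eta>"
    have \<Gamma>: "0 < ?\<Gamma>" using Gamma_pos[OF _ False] lam by simp
    have "\<bar>mask_bjl \<nu> lam t \<rho> \<epsilon> g j l \<xi>\<bar>\<^sup>2 + \<bar>mask_bjl \<nu> lam t \<rho> \<epsilon> g j l (E_mat *v \<xi>)\<bar>\<^sup>2 =
        S \<eta> / ?\<Gamma> * (\<bar>gamma_quot \<nu> \<epsilon> (real lam ^ j) (\<eta> $ 2) (\<eta> $ 1) l\<bar>\<^sup>2 +
          \<bar>gamma_quot \<nu> \<epsilon> (real lam ^ j) (\<eta> $ 1) (\<eta> $ 2) l\<bar>\<^sup>2)" for l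
      unfolding mask_bjl_eq swap \<eta>_def[symmetric] angular_def sym H\<eta>
      using \<Gamma> S_range(1)[of \<eta>]
      by (simp add: \<eta>'_def E_mat_mult power_mult_distrib power_divide field_simps)
    then have "(\<Sum>l\<in>?I. \<bar>mask_bjl \<nu> lam t \<rho> \<epsilon> g j l \<xi>\<bar>\<^sup>2 + \<bar>mask_bjl \<nu> lam t \<rho> \<epsilon> g j l (E_mat *v \<xi>)\<bar>\<^sup>2) =
        S \<eta> / ?\<Gamma> * ?\<Gamma>"
      unfolding Gamma_fn_def by (simp only: sum_distrib_left)
    then show ?thesis using \<Gamma> by simp
  qed
  then show ?thesis unfolding mask_a_eq \<eta>_def[symmetric] S_def by simp
qed

lemma Omega_lattice:
  assumes "w \<in> Omega_set lam" shows "N * w $ i \<in> \<int>" "0 \<le> w $ i" "w $ i < 1"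
proof -
  obtain z where z: "z \<in> Z2" "w = matrix_inv (M_mat lam) *v z" using assms unfolding Omega_set_def by auto
  have inv: "invertible (M_mat lam)"
    unfolding invertible_def
  proof (intro exI conjI)
    show "M_mat lam ** mat (1 / N) = mat 1" "mat (1 / N) ** M_mat lam = mat 1"
      unfolding M_mat_def N_def[symmetric] using N
      by (simp_all add: vec_eq_iff forall_2 mat_def matrix_matrix_mult_def sum_2)
  qed
  have "N *\<^sub>R w = M_mat lam *v (matrix_inv (M_mat lam) *v z)" unfolding M_mat_mult z(2) ..
  also have "\<dots> = z"
  proof -
    have "M_mat lam ** matrix_inv (M_mat lam) = mat 1"
      using someI_ex[OF inv[unfolded invertible_def]] unfolding matrix_inv_def by blast
    then show ?thesis by (simp add: matrix_vector_mul_assoc)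
  qed
  finally have "N *\<^sub>R w = z" .
  then show "N * w $ i \<in> \<int>" using z(1) unfolding Z2_def by auto
  show "0 \<le> w $ i" "w $ i < 1" using assms unfolding Omega_set_def by auto
qed

text \<open>
  Up to \<open>2\<pi>\<int>\<^sup>2\<close>, points of \<open>\<sigma>\<^sub>\<phi>\<close> are within \<open>\<rho>\<pi>/N\<close> of the origin in each coordinate, so
  differences of two such points are smaller than \<open>2\<pi>/N\<close>, the mesh of the lattice \<open>2\<pi> M\<^sup>-\<^sup>1 \<int>\<^sup>2\<close>.
\<close>

lemma sigma_disjoint:
  assumes w: "w \<in> Omega_set lam - {0}"
    and \<xi>: "\<xi> \<in> sigma_set (phi_fn \<nu> lam t \<rho>)" "\<xi> + (2 * pi) *\<^sub>R w \<in> sigma_set (phi_fn \<nu> lam t \<rho>)"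
  shows False
proof -
  obtain k where k: "k \<in> Z2" "phi_fn \<nu> lam t \<rho> (\<xi> + (2 * pi) *\<^sub>R k) \<noteq> 0"
    using sigma_shift[OF \<xi>(1)] .
  obtain k' where k': "k' \<in> Z2" "phi_fn \<nu> lam t \<rho> (\<xi> + (2 * pi) *\<^sub>R w + (2 * pi) *\<^sub>R k') \<noteq> 0"
    using sigma_shift[OF \<xi>(2)] .
  have "w $ i = 0" for i
  proof -
    define u where "u = w $ i + k' $ i - k $ i"
    have "\<bar>\<xi> $ i + 2 * pi * k $ i\<bar> < \<rho> * pi / N" "\<bar>\<xi> $ i + 2 * pi * w $ i + 2 * pi * k' $ i\<bar> < \<rho> * pi / N"
      using phi_support[OF k(2), of i] phi_support[OF k'(2), of i] by simp_all
    moreover have "2 * pi * u = (\<xi> $ i + 2 * pi * w $ i + 2 * pi * k' $ i) - (\<xi> $ i + 2 * pi * k $ i)"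
      unfolding u_def by (simp add: algebra_simps)
    ultimately have "\<bar>2 * pi * u\<bar> < 2 * (\<rho> * pi / N)" by linarith
    moreover have "\<bar>2 * pi * u\<bar> = (2 * pi) * \<bar>u\<bar>" by (simp add: abs_mult)
    moreover have "2 * (\<rho> * pi / N) = (2 * pi) * (\<rho> / N)" by simp
    ultimately have "(2 * pi) * \<bar>u\<bar> < (2 * pi) * (\<rho> / N)" by linarith
    then have "\<bar>u\<bar> < \<rho> / N" by (rule mult_left_less_imp_less) simp
    then have "\<bar>N * u\<bar> < 1" using N \<rho> by (simp add: abs_mult field_simps)
    moreover have "N * u \<in> \<int>"
    proof -
      have "N \<in> \<int>" unfolding N_def by simp
      moreover have "k $ i \<in> \<int>" "k' $ i \<in> \<int>" using k(1) k'(1) unfolding Z2_def by auto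
      moreover have "N * u = N * w $ i + N * k' $ i - N * k $ i" unfolding u_def by (simp add: algebra_simps)
      ultimately show ?thesis using Omega_lattice(1)[of w i] w by auto
    qed
    ultimately have "N * u = 0" using Ints_nonzero_abs_less1 by blast
    then have "w $ i = k $ i - k' $ i" using N unfolding u_def by auto
    then have "w $ i \<in> \<int>" using k(1) k'(1) unfolding Z2_def by auto
    moreover have "\<bar>w $ i\<bar> < 1" using Omega_lattice(2,3)[of w i] w by auto
    ultimately show ?thesis using Ints_nonzero_abs_less1 by blast
  qed
  then have "w = 0" by (simp add: vec_eq_iff)
  then show False using w by simp
qed

lemma g_on_support:
  assumes "\<xi> \<in> closure {\<xi>. phi_fn \<nu> lam t \<rho> \<xi> \<noteq> 0}" shows "g \<xi> = 1"
proof (rule continuous_constant_on_closure[of "{\<xi>. phi_fn \<nu> lam t \<rho> \<xi> \<noteq> 0}" g 1 \<xi>])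
  have "continuous_on UNIV g"
    using g_torus_smooth unfolding torus_smooth_def Csmooth_def by (metis Ck.simps(1))
  then show "continuous_on (closure {\<xi>. phi_fn \<nu> lam t \<rho> \<xi> \<noteq> 0}) g"
    by (rule continuous_on_subset) simp
  show "g \<xi> = 1" if "\<xi> \<in> {\<xi>. phi_fn \<nu> lam t \<rho> \<xi> \<noteq> 0}" for \<xi>
    using phi_support_H[of \<xi>] that unfolding g_def by simp
qed (rule assms)

lemma mask_a_le_g: "\<bar>mask_a \<nu> lam t \<rho> \<xi>\<bar>\<^sup>2 \<le> g \<xi>"
proof -
  have "0 \<le> g (wrap2 \<xi>) - (a0 (wrap2 \<xi>))\<^sup>2"
    unfolding g_minus_a0 using S_range(1) by simp
  then show ?thesis unfolding mask_a_eq g_def by (simp add: H_wrap2)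
qed

end

theorem corollary7:
  fixes \<nu> :: "real \<Rightarrow> real" and lam :: nat and \<epsilon> t \<rho> :: real
  assumes "transition_fn \<nu>" and "mono \<nu>"
    and "lam > 1" and "0 < \<epsilon>" and "\<epsilon> \<le> 1/2" and "0 < t" and "t \<le> 1" and "0 < \<rho>" and "\<rho> < 1"
  shows "\<exists>g :: real^2 \<Rightarrow> real.
    torus_smooth g \<and>
    (\<forall>\<xi> \<in> closure {\<xi>. phi_fn \<nu> lam t \<rho> \<xi> \<noteq> 0}. g \<xi> = 1) \<and>
    (\<forall>\<xi>. \<bar>mask_a \<nu> lam t \<rho> \<xi>\<bar>\<^sup>2 \<le> g \<xi>) \<and>
    torus_smooth (mask_a \<nu> lam t \<rho>) \<and>
    (\<forall>j. \<forall>l \<in> {- ell \<epsilon> (real lam ^ j)..ell \<epsilon> (real lam ^ j)}.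
       torus_smooth (mask_bjl \<nu> lam t \<rho> \<epsilon> g j l)) \<and>
    (AE \<xi> in lebesgue.
       phi_fn \<nu> lam t \<rho> (M_mat lam *v \<xi>) = mask_a \<nu> lam t \<rho> \<xi> * phi_fn \<nu> lam t \<rho> \<xi>) \<and>
    (\<forall>j. \<forall>l \<in> {- ell \<epsilon> (real lam ^ j)..ell \<epsilon> (real lam ^ j)}.
       AE \<xi> in lebesgue.
         psi_fn \<nu> lam t \<rho> \<epsilon> j l (M_mat lam *v \<xi>) =
           mask_bjl \<nu> lam t \<rho> \<epsilon> g j l \<xi> * phi_fn \<nu> lam t \<rho> \<xi>) \<and>
    (\<forall>j. AE \<xi> in lebesgue. \<xi> \<in> sigma_set (phi_fn \<nu> lam t \<rho>) \<longrightarrow>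
       \<bar>mask_a \<nu> lam t \<rho> \<xi>\<bar>\<^sup>2 +
       (\<Sum>l = - ell \<epsilon> (real lam ^ j)..ell \<epsilon> (real lam ^ j).
          \<bar>mask_bjl \<nu> lam t \<rho> \<epsilon> g j l \<xi>\<bar>\<^sup>2 +
          \<bar>mask_bjl \<nu> lam t \<rho> \<epsilon> g j l (E_mat *v \<xi>)\<bar>\<^sup>2) = 1) \<and>
    (\<forall>j. \<forall>w \<in> Omega_set lam - {0}.
       AE \<xi> in lebesgue.
         \<xi> \<in> sigma_set (phi_fn \<nu> lam t \<rho>) \<inter>
             (\<lambda>\<zeta>. \<zeta> - (2 * pi) *\<^sub>R w) ` sigma_set (phi_fn \<nu> lam t \<rho>) \<longrightarrow>
         mask_a \<nu> lam t \<rho> \<xi> * mask_a \<nu> lam t \<rho> (\<xi> + (2 * pi) *\<^sub>R w) +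
         (\<Sum>l = - ell \<epsilon> (real lam ^ j)..ell \<epsilon> (real lam ^ j).
            mask_bjl \<nu> lam t \<rho> \<epsilon> g j l \<xi> * mask_bjl \<nu> lam t \<rho> \<epsilon> g j l (\<xi> + (2 * pi) *\<^sub>R w) +
            mask_bjl \<nu> lam t \<rho> \<epsilon> g j l (E_mat *v \<xi>) *
              mask_bjl \<nu> lam t \<rho> \<epsilon> g j l (E_mat *v \<xi> + (2 * pi) *\<^sub>R w)) = 0)"
proof -
  interpret shearlet_masks \<nu> \<epsilon> lam t \<rho>
    by unfold_locales (use assms in auto)
  have shift: "\<xi> + (2 * pi) *\<^sub>R w \<in> sigma_set (phi_fn \<nu> lam t \<rho>)"
    if "\<xi> \<in> (\<lambda>\<zeta>. \<zeta> - (2 * pi) *\<^sub>R w) ` sigma_set (phi_fn \<nu> lam t \<rho>)" for \<xi> w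
    using that by auto
  show ?thesis
  proof (intro exI[of _ g] conjI allI ballI AE_I2 impI)
    show "torus_smooth g" by (rule g_torus_smooth)
  next
    fix \<xi> assume "\<xi> \<in> closure {\<xi>. phi_fn \<nu> lam t \<rho> \<xi> \<noteq> 0}"
    then show "g \<xi> = 1" by (rule g_on_support)
  next
    fix j w \<xi>
    assume "w \<in> Omega_set lam - {0}" and "\<xi> \<in> sigma_set (phi_fn \<nu> lam t \<rho>) \<inter>
        (\<lambda>\<zeta>. \<zeta> - (2 * pi) *\<^sub>R w) ` sigma_set (phi_fn \<nu> lam t \<rho>)"
    then have False using sigma_disjoint shift by blast
    then show "mask_a \<nu> lam t \<rho> \<xi> * mask_a \<nu> lam t \<rho> (\<xi> + (2 * pi) *\<^sub>R w) +
         (\<Sum>l = - ell \<epsilon> (real lam ^ j)..ell \<epsilon> (real lam ^ j).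
            mask_bjl \<nu> lam t \<rho> \<epsilon> g j l \<xi> * mask_bjl \<nu> lam t \<rho> \<epsilon> g j l (\<xi> + (2 * pi) *\<^sub>R w) +
            mask_bjl \<nu> lam t \<rho> \<epsilon> g j l (E_mat *v \<xi>) *
              mask_bjl \<nu> lam t \<rho> \<epsilon> g j l (E_mat *v \<xi> + (2 * pi) *\<^sub>R w)) = 0" ..
  qed (assumption | rule mask_a_le_g mask_a_torus_smooth mask_bjl_torus_smooth refinement_a refinement_b
      perfect_reconstruction)+
qed

end
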